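(* Let $(P,\leq)$ be a nonempty partially ordered set and $K$ a field. Then $(\mathcal{A}(P),\leq_{\mathcal{A}})$ is a partially ordered set, and there is an order-isomorphism $$(\mathrm{Spec}(L_K(E_P)),\subseteq)\ \cong\ (\mathcal{A}(P),\leq_{\mathcal{A}}).$$
   Context: Rings and algebras are associative, not necessarily unital. A prime ideal of a ring $R$ is a proper two-sided ideal $I$ such that for all $x,y\in R$, $xRy\subseteq I$ implies $x\in I$ or $y\in I$; $\mathrm{Spec}(R)$ is the set of prime ideals of $R$, ordered by inclusion. A (directed) graph $E=(E^0,E^1,\mathbf{s},\mathbf{r})$ consists of sets $E^0$ (vertices), $E^1$ (edges) and source and range functions $\mathbf{s},\mathbf{r}:E^1\to E^0$. A vertex $v$ is regular if $\mathbf{s}^{-1}(v)$ is finite and nonempty. For a field $K$ and a (nonempty) graph $E$, the Leavitt path algebra $L_K(E)$ is the $K$-algebra generated by $\{v\mid v\in E^0\}\cup\{e,e^*\mid e\in E^1\}$ subject to: (V) $vw=\delta_{v,w}v$ for $v,w\in E^0$; (E1) $\mathbf{s}(e)e=e\mathbf{r}(e)=e$ for $e\in E^1$; (E2) $\mathbf{r}(e)e^*=e^*\mathbf{s}(e)=e^*$ for $e\in E^1$; (CK1) $e^*f=\delta_{e,f}\mathbf{r}(e)$ for $e,f\in E^1$; (CK2) $v=\sum_{e\in\mathbf{s}^{-1}(v)}ee^*$ for every regular $v\in E^0$. For a poset $(P,\leq)$, the graph $E_P$ has $E_P^0=\{v_p\mid p\in P\}$ and $E_P^1=\{e^i_{p,q}\mid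 i\in\mathbb{N},\ p,q\in P,\ p>q\}$ (with $\mathbb{N}=\{0,1,2,\dots\}$), where $\mathbf{s}(e^i_{p,q})=v_p$ and $\mathbf{r}(e^i_{p,q})=v_q$. A subset $S$ of a poset is downward directed if it is nonempty and for all $p,q\in S$ there is $r\in S$ with $r\leq p$ and $r\leq q$. For nonempty subsets $S_1,S_2\subseteq P$ write $S_1\preceq S_2$ if for every $s_2\in S_2$ there is $s_1\in S_1$ with $s_1\leq s_2$; write $S_1\approx S_2$ if $S_1\preceq S_2$ and $S_2\preceq S_1$. This is an equivalence relation; $[S]$ denotes the class of $S$. Define $$\mathcal{A}(P)=P\cup\{x_{[S]}\mid S\subseteq P\text{ downward directed with no least element}\}$$ (the $x_{[S]}$ being new elements, one for each $\approx$-class), and define the binary relation $\leq_{\mathcal{A}}$ on $\mathcal{A}(P)$ by $p\leq_{\mathcal{A}}q$ if one of the following holds: (1) $p,q\in P$ and $p\leq q$; (2) $p\in P$, $q=x_{[S]}\in\mathcal{A}(P)\setminus P$, and $p\leq s$ for all $s\in S$; (3) $p=x_{[S]}\in\mathcal{A}(P)\setminus P$, $q\in P$, and $s\leq q$ for some $s\in S$; (4) $p=x_{[S]}$ and $q=x_{[T]}$ are both in $\mathcal{A}(P)\setminus P$ and $S\preceq T$. *)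

theory Defs
  imports
    "HOL-Library.Poly_Mapping"
    "HOL-Algebra.QuotRing"
    "HOL-Algebra.Module"
    "Graph_Theory.Digraph"
begin

section \<open>Rings without unit and their prime spectrum\<close>

text \<open>
  Rings need not have a unit, so the locales \<open>ring\<close>, \<open>ideal\<close> and \<open>primeideal\<close> of HOL-Algebra do
  not apply. The record \<open>ring\<close> (and its extension \<open>module\<close>) is reused as the signature; its field
  \<open>one\<close> is never inspected.
\<close>

locale rng = abelian_group R for R (structure) +
  assumes m_closed: "\<lbrakk>x \<in> carrier R; y \<in> carrier R\<rbrakk> \<Longrightarrow> x \<otimes> y \<in> carrier R"
    and m_assoc: "\<lbrakk>x \<in> carrier R; y \<in> carrier R; z \<in> carrier R\<rbrakk>
      \<Longrightarrow> (x \<otimes> y) \<otimes> z = x \<otimes> (y \<otimes> z)"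
    and l_distr: "\<lbrakk>x \<in> carrier R; y \<in> carrier R; z \<in> carrier R\<rbrakk>
      \<Longrightarrow> (x \<oplus> y) \<otimes> z = x \<otimes> z \<oplus> y \<otimes> z"
    and r_distr: "\<lbrakk>x \<in> carrier R; y \<in> carrier R; z \<in> carrier R\<rbrakk>
      \<Longrightarrow> z \<otimes> (x \<oplus> y) = z \<otimes> x \<oplus> z \<otimes> y"

locale rng_ideal = additive_subgroup I R + rng R for I and R (structure) +
  assumes I_l_closed: "\<lbrakk>a \<in> I; x \<in> carrier R\<rbrakk> \<Longrightarrow> x \<otimes> a \<in> I"
    and I_r_closed: "\<lbrakk>a \<in> I; x \<in> carrier R\<rbrakk> \<Longrightarrow> a \<otimes> x \<in> I"

locale rng_prime_ideal = rng_ideal I R for I and R (structure) +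
  assumes I_proper: "I \<noteq> carrier R"
    and I_prime: "\<lbrakk>x \<in> carrier R; y \<in> carrier R; \<And>r. r \<in> carrier R \<Longrightarrow> x \<otimes> r \<otimes> y \<in> I\<rbrakk>
      \<Longrightarrow> x \<in> I \<or> y \<in> I"

definition Spec :: "('a, 'm) ring_scheme \<Rightarrow> 'a set set" where
  "Spec R = {I. rng_prime_ideal I R}"


section \<open>Algebras given by generators and relations\<close>

text \<open>
  With words as a monoid under concatenation, the convolution product of \<open>Poly_Mapping\<close> makes
  \<open>'g list \<Rightarrow>\<^sub>0 'k\<close> the free unital \<open>'k\<close>-algebra on \<open>'g\<close>.
\<close>

instantiation list :: (type) monoid_add
begin

definition zero_list :: "'a list" where "zero_list = []"

definition plus_list :: "'a list \<Rightarrow> 'a list \<Rightarrow> 'a list" where "plus_list = (@)"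

instance by standard (simp_all add: zero_list_def plus_list_def)

end

text \<open>The free non-unital algebra on \<open>G\<close>; only nonempty words in \<open>G\<close> are allowed.\<close>

definition free_algebra :: "'g set \<Rightarrow> ('k::field, 'g list \<Rightarrow>\<^sub>0 'k) module" where
  "free_algebra G =
     \<lparr>carrier = {f. Poly_Mapping.keys f \<subseteq> lists G - {[]}},
      mult = (*), one = undefined, zero = 0, add = (+),
      smult = (\<lambda>c. Poly_Mapping.map ((*) c))\<rparr>"

definition algebra_ideal_generated :: "('k, 'a, 'm) module_scheme \<Rightarrow> 'a set \<Rightarrow> 'a set" where
  "algebra_ideal_generated A X =
     \<Inter>{I. rng_ideal I A \<and> (\<forall>c. \<forall>a\<in>I. c \<odot>\<^bsub>A\<^esub> a \<in> I) \<and> X \<subseteq> I}"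

definition quotient_algebra :: "('k, 'a) module \<Rightarrow> 'a set \<Rightarrow> ('k, 'a set) module" where
  "quotient_algebra A I =
     ring.extend (A Quot I) (module.fields (\<lambda>c X. \<Union>x\<in>X. I +>\<^bsub>A\<^esub> (c \<odot>\<^bsub>A\<^esub> x)))"

definition presented_algebra ::
    "'g set \<Rightarrow> ('g list \<Rightarrow>\<^sub>0 'k) set \<Rightarrow> ('k::field, ('g list \<Rightarrow>\<^sub>0 'k) set) module" where
  "presented_algebra G X =
     quotient_algebra (free_algebra G) (algebra_ideal_generated (free_algebra G) X)"


section \<open>Leavitt path algebras\<close>

definition regular_vertex :: "('v, 'e) pre_digraph \<Rightarrow> 'v \<Rightarrow> bool" where
  "regular_vertex E v \<longleftrightarrow> v \<in> verts E \<and> finite (out_arcs E v) \<and> out_arcs E v \<noteq> {}"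

datatype ('v, 'e) lpa_gen = Vertex 'v | Edge 'e | Ghost 'e

definition lpa_gens :: "('v, 'e) pre_digraph \<Rightarrow> ('v, 'e) lpa_gen set" where
  "lpa_gens E = Vertex ` verts E \<union> Edge ` arcs E \<union> Ghost ` arcs E"

abbreviation word :: "'g list \<Rightarrow> 'g list \<Rightarrow>\<^sub>0 'k::field" where
  "word w \<equiv> Poly_Mapping.single w 1"

text \<open>The relations \<open>l = r\<close>, given as the elements \<open>l - r\<close>, in the order (V), (E1), (E2), (CK1), (CK2).\<close>

definition lpa_rels :: "('v, 'e) pre_digraph \<Rightarrow> (('v, 'e) lpa_gen list \<Rightarrow>\<^sub>0 'k::field) set" where
  "lpa_rels E =
     {word [Vertex v, Vertex w] - (if v = w then word [Vertex v] else 0) | v w.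
        v \<in> verts E \<and> w \<in> verts E} \<union>
     {word [Vertex (tail E e), Edge e] - word [Edge e] | e. e \<in> arcs E} \<union>
     {word [Edge e, Vertex (head E e)] - word [Edge e] | e. e \<in> arcs E} \<union>
     {word [Vertex (head E e), Ghost e] - word [Ghost e] | e. e \<in> arcs E} \<union>
     {word [Ghost e, Vertex (tail E e)] - word [Ghost e] | e. e \<in> arcs E} \<union>
     {word [Ghost e, Edge f] - (if e = f then word [Vertex (head E e)] else 0) | e f.
        e \<in> arcs E \<and> f \<in> arcs E} \<union>
     {word [Vertex v] - (\<Sum>e\<in>out_arcs E v. word [Edge e, Ghost e]) | v. regular_vertex E v}"

definition leavitt_path_algebra ::
    "'k itself \<Rightarrow> ('v, 'e) pre_digraph \<Rightarrow>
      ('k::field, (('v, 'e) lpa_gen list \<Rightarrow>\<^sub>0 'k) set) module" where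
  "leavitt_path_algebra K E = presented_algebra (lpa_gens E) (lpa_rels E)"


section \<open>The graph of a poset\<close>

text \<open>
  A poset is a set \<open>P\<close> of elements of a type of class \<open>order\<close>. The vertex of \<open>p\<close> is \<open>p\<close> itself, and
  \<open>(i, p, q)\<close> is the \<open>i\<close>-th edge from \<open>p\<close> to \<open>q\<close>.
\<close>

definition poset_graph :: "'p::order set \<Rightarrow> ('p, nat \<times> 'p \<times> 'p) pre_digraph" where
  "poset_graph P =
     \<lparr>verts = P,
      arcs = {(i, p, q) | i p q. p \<in> P \<and> q \<in> P \<and> p > q},
      tail = (\<lambda>(i, p, q). p),
      head = (\<lambda>(i, p, q). q)\<rparr>"


section \<open>Adjoining infima of downward directed sets\<close>

definition downward_directed :: "'p::order set \<Rightarrow> bool" where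
  "downward_directed S \<longleftrightarrow> S \<noteq> {} \<and> (\<forall>p\<in>S. \<forall>q\<in>S. \<exists>r\<in>S. r \<le> p \<and> r \<le> q)"

definition has_least :: "'p::order set \<Rightarrow> bool" where
  "has_least S \<longleftrightarrow> (\<exists>m\<in>S. \<forall>s\<in>S. m \<le> s)"

definition set_le :: "'p::order set \<Rightarrow> 'p set \<Rightarrow> bool" (infix \<open>\<preceq>\<close> 50) where
  "S \<preceq> T \<longleftrightarrow> (\<forall>t\<in>T. \<exists>s\<in>S. s \<le> t)"

definition set_equiv :: "'p::order set \<Rightarrow> ('p set \<times> 'p set) set" where
  "set_equiv P = {(S, T). S \<subseteq> P \<and> T \<subseteq> P \<and> S \<noteq> {} \<and> T \<noteq> {} \<and> S \<preceq> T \<and> T \<preceq> S}"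

definition limit_sets :: "'p::order set \<Rightarrow> 'p set set" where
  "limit_sets P = {S. S \<subseteq> P \<and> downward_directed S \<and> \<not> has_least S}"

datatype 'p completion = Orig 'p | Limit "'p set set"

abbreviation limit_of :: "'p::order set \<Rightarrow> 'p set \<Rightarrow> 'p completion" where
  "limit_of P S \<equiv> Limit (set_equiv P `` {S})"

definition completion :: "'p::order set \<Rightarrow> 'p completion set" where
  "completion P = Orig ` P \<union> limit_of P ` limit_sets P"

text \<open>
  The rules do not depend on the choice of representatives of the classes, so quantifying
  existentially over them, as is done here, agrees with quantifying universally.
\<close>

inductive_set completion_le :: "'p::order set \<Rightarrow> ('p completion \<times> 'p completion) set"
  for P :: "'p set" where
  "\<lbrakk>p \<in> P; q \<in> P; p \<le> q\<rbrakk> \<Longrightarrow> (Orig p, Orig q) \<in> completion_le P"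
| "\<lbrakk>p \<in> P; S \<in> limit_sets P; \<forall>s\<in>S. p \<le> s\<rbrakk> \<Longrightarrow> (Orig p, limit_of P S) \<in> completion_le P"
| "\<lbrakk>S \<in> limit_sets P; q \<in> P; \<exists>s\<in>S. s \<le> q\<rbrakk> \<Longrightarrow> (limit_of P S, Orig q) \<in> completion_le P"
| "\<lbrakk>S \<in> limit_sets P; T \<in> limit_sets P; S \<preceq> T\<rbrakk>
    \<Longrightarrow> (limit_of P S, limit_of P T) \<in> completion_le P"

end

theory Submission
  imports Defs "HOL-Library.Sublist" "Graph_Theory.Arc_Walk"
begin

text \<open>
  The prime ideals of the Leavitt path algebra are the prime ideals of the free algebra containing
  the defining relations. No vertex of \<open>E\<^sub>P\<close> is regular, so modulo such an ideal \<open>I\<close> every element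
  is a linear combination of terms \<open>a b*\<close> with paths \<open>a\<close>, \<open>b\<close> ending at a common vertex outside \<open>I\<close>.
  As \<open>E\<^sub>P\<close> is acyclic and has infinitely many parallel copies of each edge, such an
  element can be multiplied on both sides to a vertex outside \<open>I\<close>, unless it is zero. Hence an ideal
  is determined by the vertices outside it, and it is prime if and only if these form a downward
  directed set; this set is always upward closed. Every downward directed upward closed set arises,
  by means of a representation on functions on paths. Finally, these sets, ordered by reverse
  inclusion, are the completion of \<open>P\<close>: \<open>p\<close> and \<open>x\<^sub>[\<^sub>S\<^sub>]\<close> correspond to the upward closures of \<open>{p}\<close>
  and \<open>S\<close>.
\<close>

section \<open>Prime ideals of quotients\<close>

text \<open>The elements of the Leavitt path algebra are cosets; computing in the free algebra
  modulo \<open>I\<close> avoids them and treats every quotient of the algebra in the same way. In a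
  general graph the vertices do not determine an ideal: cycles, and vertices with only finitely many
  edges whose heads stay outside the ideal, contribute further data. Here there are no cycles, and
  all copies of an edge have the same head, so modulo any ideal a vertex emits either no edge with
  nonzero head or infinitely many. This is the assumption \<open>fresh\<close>, and the reason for
  the infinite multiplicity in \<open>E_P\<close>. The multiplication argument shows at the same
  time that distinct normal forms are linearly independent modulo \<open>I\<close>. What rewriting
  cannot show is that a vertex of a given upset survives; the representation provides this. Two
  ideals of which neither is known to contain the other are compared through their
  intersection.\<close>

lemma (in rng) rng_idealI:
  assumes "I \<subseteq> carrier R" "\<zero> \<in> I"
    and "\<And>x y. \<lbrakk>x \<in> I; y \<in> I\<rbrakk> \<Longrightarrow> x \<oplus> y \<in> I"
    and "\<And>x. x \<in> I \<Longrightarrow> \<ominus> x \<in> I"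
    and "\<And>a x. \<lbrakk>a \<in> I; x \<in> carrier R\<rbrakk> \<Longrightarrow> x \<otimes> a \<in> I"
    and "\<And>a x. \<lbrakk>a \<in> I; x \<in> carrier R\<rbrakk> \<Longrightarrow> a \<otimes> x \<in> I"
  shows "rng_ideal I R"
proof -
  have "subgroup I (add_monoid R)"
    using assms by (intro add.subgroupI) (auto simp: a_inv_def)
  then show ?thesis
    using assms rng_axioms
    by (intro rng_ideal.intro additive_subgroup.intro rng_ideal_axioms.intro) auto
qed

text \<open>Only \<open>A\<close> is assumed to be a rng. The axioms of \<open>B\<close> are
  transported along \<open>\<pi>\<close>, so for a quotient record just the compatibility of the
  coset map with the operations remains to be checked.\<close>

locale rng_surj = rng A for A (structure) and B (structure) and \<pi> +
  assumes carrier_eq: "carrier B = \<pi> ` carrier A"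
    and map_zero: "\<pi> \<zero> = \<zero>\<^bsub>B\<^esub>"
    and map_add: "\<lbrakk>x \<in> carrier A; y \<in> carrier A\<rbrakk> \<Longrightarrow> \<pi> (x \<oplus> y) = \<pi> x \<oplus>\<^bsub>B\<^esub> \<pi> y"
    and map_mult: "\<lbrakk>x \<in> carrier A; y \<in> carrier A\<rbrakk> \<Longrightarrow> \<pi> (x \<otimes> y) = \<pi> x \<otimes>\<^bsub>B\<^esub> \<pi> y"
begin

lemma codomain_rng: "rng B"
proof -
  have "abelian_group B"
  proof (rule abelian_groupI)
    fix x assume "x \<in> carrier B"
    then obtain a where a: "a \<in> carrier A" "x = \<pi> a" by (auto simp: carrier_eq)
    show "\<exists>y\<in>carrier B. y \<oplus>\<^bsub>B\<^esub> x = \<zero>\<^bsub>B\<^esub>"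
    proof (rule bexI)
      show "\<pi> (\<ominus> a) \<oplus>\<^bsub>B\<^esub> x = \<zero>\<^bsub>B\<^esub>"
        using a by (simp add: l_neg map_zero flip: map_add)
    qed (use a in \<open>auto simp: carrier_eq\<close>)
  qed (auto simp: carrier_eq a_ac simp flip: map_add map_zero
      intro!: imageI arg_cong[where f = \<pi>])
  then show ?thesis
    by (intro rng.intro rng_axioms.intro)
      (auto simp: carrier_eq m_closed m_assoc l_distr r_distr simp flip: map_add map_mult
        intro!: imageI arg_cong[where f = \<pi>])
qed

lemma map_a_inv:
  assumes "x \<in> carrier A" shows "\<pi> (\<ominus> x) = \<ominus>\<^bsub>B\<^esub> \<pi> x"
proof -
  interpret B: rng B by (rule codomain_rng)
  have "\<pi> (\<ominus> x) \<oplus>\<^bsub>B\<^esub> \<pi> x = \<zero>\<^bsub>B\<^esub>"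
    using assms by (simp add: l_neg map_zero flip: map_add)
  then show ?thesis
    using assms by (intro B.minus_equality[symmetric]) (auto simp: carrier_eq)
qed

lemma map_minus: "\<lbrakk>x \<in> carrier A; y \<in> carrier A\<rbrakk> \<Longrightarrow> \<pi> (x \<ominus> y) = \<pi> x \<ominus>\<^bsub>B\<^esub> \<pi> y"
  by (simp add: a_minus_def map_add map_a_inv)

lemma prime_preimage:
  assumes "rng_prime_ideal J B" shows "rng_prime_ideal {x \<in> carrier A. \<pi> x \<in> J} A"
proof -
  interpret J: rng_prime_ideal J B by fact
  have "rng_ideal {x \<in> carrier A. \<pi> x \<in> J} A"
    by (rule rng_idealI) (auto simp: map_zero map_add map_mult map_a_inv m_closed carrier_eq
        intro: J.I_l_closed J.I_r_closed)
  moreover have "{x \<in> carrier A. \<pi> x \<in> J} \<noteq> carrier A"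
    using J.I_proper J.a_subset by (auto simp: carrier_eq)
  moreover have "x \<in> J' \<or> y \<in> J'" if "J' = {x \<in> carrier A. \<pi> x \<in> J}" "x \<in> carrier A" "y \<in> carrier A"
    "\<And>r. r \<in> carrier A \<Longrightarrow> x \<otimes> r \<otimes> y \<in> J'" for x y J'
    using J.I_prime[of "\<pi> x" "\<pi> y"] that by (force simp: carrier_eq map_mult m_closed)
  ultimately show ?thesis
    by (intro rng_prime_ideal.intro rng_prime_ideal_axioms.intro) blast+
qed

text \<open>Two elements with the same image differ by an element of the kernel, so an ideal that
  contains the kernel is a union of fibres of \<open>\<pi>\<close>.\<close>

lemma mem_image_iff:
  assumes "rng_ideal I A" "{x \<in> carrier A. \<pi> x = \<zero>\<^bsub>B\<^esub>} \<subseteq> I" "x \<in> carrier A"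
  shows "\<pi> x \<in> \<pi> ` I \<longleftrightarrow> x \<in> I"
proof
  interpret I: rng_ideal I A by fact
  interpret B: rng B by (rule codomain_rng)
  assume "\<pi> x \<in> \<pi> ` I"
  then obtain i where i: "i \<in> I" "\<pi> x = \<pi> i" by auto
  then have "\<pi> (x \<ominus> i) = \<zero>\<^bsub>B\<^esub>"
    using assms(3) by (simp add: map_minus carrier_eq B.minus_eq B.r_neg)
  then have "x \<ominus> i \<in> I" using assms i by auto
  then have "(x \<ominus> i) \<oplus> i \<in> I" using i by auto
  then show "x \<in> I" using assms(3) i by (simp add: a_minus_def a_assoc l_neg)
qed auto

lemma prime_image:
  assumes "rng_prime_ideal I A" "{x \<in> carrier A. \<pi> x = \<zero>\<^bsub>B\<^esub>} \<subseteq> I"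
  shows "rng_prime_ideal (\<pi> ` I) B"
proof -
  interpret I: rng_prime_ideal I A by fact
  interpret B: rng B by (rule codomain_rng)
  note mem = mem_image_iff[OF I.rng_ideal_axioms assms(2)]
  have "rng_ideal (\<pi> ` I) B"
    using I.a_subset
    by (intro B.rng_idealI) (auto 4 3 simp: carrier_eq simp flip: map_zero map_add map_mult map_a_inv
        intro: I.I_l_closed I.I_r_closed)
  moreover have "\<pi> ` I \<noteq> carrier B"
    using I.I_proper I.a_subset mem by (auto simp: carrier_eq)
  moreover have "x \<in> \<pi> ` I \<or> y \<in> \<pi> ` I" if xy: "x \<in> carrier B" "y \<in> carrier B"
    and r: "\<And>r. r \<in> carrier B \<Longrightarrow> x \<otimes>\<^bsub>B\<^esub> r \<otimes>\<^bsub>B\<^esub> y \<in> \<pi> ` I" for x y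
  proof -
    obtain a b where ab: "a \<in> carrier A" "x = \<pi> a" "b \<in> carrier A" "y = \<pi> b"
      using xy by (auto simp: carrier_eq)
    have "a \<otimes> s \<otimes> b \<in> I" if "s \<in> carrier A" for s
      using r[of "\<pi> s"] that ab mem[of "a \<otimes> s \<otimes> b"] by (simp add: carrier_eq map_mult m_closed)
    then have "a \<in> I \<or> b \<in> I" using I.I_prime ab by blast
    then show ?thesis using ab by auto
  qed
  ultimately show ?thesis
    by (intro rng_prime_ideal.intro rng_prime_ideal_axioms.intro) blast+
qed

lemma Spec_preimage_bij:
  "bij_betw (\<lambda>J. {x \<in> carrier A. \<pi> x \<in> J}) (Spec B)
     {I \<in> Spec A. {x \<in> carrier A. \<pi> x = \<zero>\<^bsub>B\<^esub>} \<subseteq> I}"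
proof (rule bij_betw_byWitness[where f' = "image \<pi>"])
  show "\<forall>J\<in>Spec B. \<pi> ` {x \<in> carrier A. \<pi> x \<in> J} = J"
  proof
    fix J assume "J \<in> Spec B"
    then interpret J: rng_prime_ideal J B by (simp add: Spec_def)
    show "\<pi> ` {x \<in> carrier A. \<pi> x \<in> J} = J"
      using J.a_subset by (auto simp: carrier_eq)
  qed
  show "\<forall>I\<in>{I \<in> Spec A. {x \<in> carrier A. \<pi> x = \<zero>\<^bsub>B\<^esub>} \<subseteq> I}. {x \<in> carrier A. \<pi> x \<in> \<pi> ` I} = I"
  proof
    fix I assume I: "I \<in> {I \<in> Spec A. {x \<in> carrier A. \<pi> x = \<zero>\<^bsub>B\<^esub>} \<subseteq> I}"
    then interpret I: rng_prime_ideal I A by (simp add: Spec_def)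
    show "{x \<in> carrier A. \<pi> x \<in> \<pi> ` I} = I"
      using mem_image_iff[OF I.rng_ideal_axioms] I I.a_subset by blast
  qed
  show "(\<lambda>J. {x \<in> carrier A. \<pi> x \<in> J}) ` Spec B
      \<subseteq> {I \<in> Spec A. {x \<in> carrier A. \<pi> x = \<zero>\<^bsub>B\<^esub>} \<subseteq> I}"
  proof (clarsimp simp: Spec_def prime_preimage)
    fix J x assume "rng_prime_ideal J B"
    then interpret J: rng_prime_ideal J B .
    show "\<zero>\<^bsub>B\<^esub> \<in> J" by simp
  qed
  show "image \<pi> ` {I \<in> Spec A. {x \<in> carrier A. \<pi> x = \<zero>\<^bsub>B\<^esub>} \<subseteq> I} \<subseteq> Spec B"
    by (auto simp: Spec_def intro: prime_image)
qed

lemma Spec_preimage_subset_iff: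
  assumes "J \<in> Spec B" "J' \<in> Spec B"
  shows "{x \<in> carrier A. \<pi> x \<in> J} \<subseteq> {x \<in> carrier A. \<pi> x \<in> J'} \<longleftrightarrow> J \<subseteq> J'"
proof -
  interpret J: rng_prime_ideal J B using assms by (simp add: Spec_def)
  show ?thesis using J.a_subset by (auto simp: carrier_eq)
qed

end

text \<open>\<open>rcoset_mult\<close> is a union over all pairs of representatives. It collapses to
  one coset because \<open>(i + x) b = i b + x j + x y\<close> for \<open>b = j + y\<close>, and the
  first two summands lie in the two-sided ideal.\<close>

lemma (in rng_ideal) rcoset_mult_rng:
  assumes "x \<in> carrier R" "y \<in> carrier R"
  shows "rcoset_mult R I (I +> x) (I +> y) = I +> (x \<otimes> y)"
proof -
  interpret abelian_subgroup I R
    by (intro abelian_subgroupI3 additive_subgroup_axioms abelian_group_axioms)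
  have "I +> (a \<otimes> b) = I +> (x \<otimes> y)" if ab: "a \<in> I +> x" "b \<in> I +> y" for a b
  proof -
    obtain i j where ij: "i \<in> I" "j \<in> I" "a = i \<oplus> x" "b = j \<oplus> y"
      using ab by (auto simp: a_r_coset_def')
    then have "i \<in> carrier R" "j \<in> carrier R" by auto
    then have "a \<otimes> b = (i \<otimes> b \<oplus> x \<otimes> j) \<oplus> x \<otimes> y"
      using ij assms by (simp add: l_distr r_distr m_closed a_ac)
    moreover have "i \<otimes> b \<oplus> x \<otimes> j \<in> I"
      using ij assms by (simp add: I_l_closed I_r_closed)
    ultimately have "a \<otimes> b \<in> I +> (x \<otimes> y)" by (auto simp: a_r_coset_def')
    then show ?thesis using a_repr_independence' assms m_closed by blast
  qed
  moreover have "x \<in> I +> x" "y \<in> I +> y" using assms a_rcos_self by auto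
  ultimately show ?thesis unfolding rcoset_mult_def by blast
qed

lemma quotient_algebra_rng_surj:
  fixes A (structure)
  assumes "rng_ideal I A" shows "rng_surj A (quotient_algebra A I) (\<lambda>x. I +>\<^bsub>A\<^esub> x)"
    and "\<And>x. x \<in> carrier A \<Longrightarrow> I +>\<^bsub>A\<^esub> x = \<zero>\<^bsub>quotient_algebra A I\<^esub> \<longleftrightarrow> x \<in> I"
proof -
  interpret rng_ideal I A by fact
  interpret abelian_subgroup I A
    by (intro abelian_subgroupI3 additive_subgroup_axioms abelian_group_axioms)
  have [simp]: "carrier (quotient_algebra A I) = a_rcosets I"
    "mult (quotient_algebra A I) = rcoset_mult A I" "zero (quotient_algebra A I) = I"
    "add (quotient_algebra A I) = set_add A"
    by (simp_all add: quotient_algebra_def ring.extend_def FactRing_def)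
  show "rng_surj A (quotient_algebra A I) (\<lambda>x. I +> x)"
  proof
    show "carrier (quotient_algebra A I) = (+>) I ` carrier A"
      by (auto simp: A_RCOSETS_def RCOSETS_def a_r_coset_def)
  qed (simp_all add: rcoset_mult_rng a_rcos_sum a_coset_join2 zero_closed a_coset_add_zero a_subset)
  show "I +> x = \<zero>\<^bsub>quotient_algebra A I\<^esub> \<longleftrightarrow> x \<in> I" if "x \<in> carrier A" for x
    using that a_rcos_self[of x] a_rcos_const[of x] by auto
qed

section \<open>Presented algebras\<close>

text \<open>As \<open>x\<close> recurs on the right, rewriting with this equation need not
  terminate. Several later proofs therefore establish an identity for sums over an arbitrary set
  \<open>W\<close> of words and then specialise \<open>W\<close> to the keys.\<close>

lemma sum_monomials:
  fixes x :: "'a \<Rightarrow>\<^sub>0 'k::comm_monoid_add"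
  shows "x = (\<Sum>w\<in>Poly_Mapping.keys x. Poly_Mapping.single w (Poly_Mapping.lookup x w))"
proof (rule poly_mapping_eqI)
  fix k
  have "(\<Sum>w\<in>Poly_Mapping.keys x. Poly_Mapping.lookup x w when w = k) = Poly_Mapping.lookup x k"
    by (simp add: when_def sum.delta in_keys_iff)
  then show "Poly_Mapping.lookup x k = Poly_Mapping.lookup (\<Sum>w\<in>Poly_Mapping.keys x. Poly_Mapping.single w (Poly_Mapping.lookup x w)) k"
    by (simp add: lookup_sum lookup_single)
qed

lemma word_mult: "word u * word v = word (u @ v)"
  by (simp add: mult_single plus_list_def)

lemma word_Nil: "word [] = 1"
  by (metis single_one zero_list_def)

lemma free_algebra_simps [simp]:
  "carrier (free_algebra G) = {f. Poly_Mapping.keys f \<subseteq> lists G - {[]}}"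
  "mult (free_algebra G) = (*)" "zero (free_algebra G) = 0" "add (free_algebra G) = (+)"
  "smult (free_algebra G) = (\<lambda>c. Poly_Mapping.map ((*) c))"
  by (simp_all add: free_algebra_def)

lemma keys_mult_subset:
  "(\<And>u v. \<lbrakk>u \<in> Poly_Mapping.keys f; v \<in> Poly_Mapping.keys g\<rbrakk> \<Longrightarrow> u + v \<in> S)
    \<Longrightarrow> Poly_Mapping.keys (f * g) \<subseteq> S"
  using keys_mult[of f g] by blast

text \<open>The factor \<open>f\<close> may contain the empty word. This covers multiplication by a
  scalar, which is a multiple of the empty word and so, unless zero, lies outside the non-unital
  free algebra.\<close>

lemma keys_mult_lists:
  assumes "Poly_Mapping.keys f \<subseteq> lists G" "Poly_Mapping.keys g \<subseteq> lists G - {[]}"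
  shows "Poly_Mapping.keys (f * g) \<subseteq> lists G - {[]}" "Poly_Mapping.keys (g * f) \<subseteq> lists G - {[]}"
proof -
  have uv: "u + v \<in> lists G - {[]}" "v + u \<in> lists G - {[]}"
    if "u \<in> Poly_Mapping.keys f" "v \<in> Poly_Mapping.keys g" for u v
    using that assms by (auto simp: plus_list_def)
  show "Poly_Mapping.keys (f * g) \<subseteq> lists G - {[]}"
    by (rule keys_mult_subset) (rule uv)
  show "Poly_Mapping.keys (g * f) \<subseteq> lists G - {[]}"
    by (rule keys_mult_subset) (rule uv)
qed

lemma rng_free_algebra: "rng (free_algebra G :: ('k::field, 'g list \<Rightarrow>\<^sub>0 'k) module)"
proof -
  have "abelian_group (free_algebra G :: ('k::field, 'g list \<Rightarrow>\<^sub>0 'k) module)"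
  proof (rule abelian_groupI, goal_cases)
    case (6 x)
    then show ?case by (intro bexI[of _ "- x"]) (auto simp: in_keys_iff)
  next
    case (1 x y)
    then show ?case using keys_add[of x y] by auto
  qed (auto simp: add_ac)
  moreover have "Poly_Mapping.keys (f * g) \<subseteq> lists G - {[]}"
    if "Poly_Mapping.keys f \<subseteq> lists G - {[]}" "Poly_Mapping.keys g \<subseteq> lists G - {[]}"
    for f g :: "'g list \<Rightarrow>\<^sub>0 'k"
    using that by (intro keys_mult_lists) auto
  ultimately show ?thesis
    by (intro rng.intro rng_axioms.intro) (simp_all add: mult.assoc distrib_left distrib_right)
qed

lemma free_algebra_a_inv:
  assumes "x \<in> carrier (free_algebra G)" shows "\<ominus>\<^bsub>free_algebra G\<^esub> x = - x"
proof -
  interpret rng "free_algebra G :: ('b, 'a list \<Rightarrow>\<^sub>0 'b) module" by (rule rng_free_algebra)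
  have "- x \<in> carrier (free_algebra G)"
    using assms by (auto simp: in_keys_iff)
  then show ?thesis using assms by (intro minus_equality) auto
qed

lemma scalar_mult_assoc:
  fixes x y :: "'g list \<Rightarrow>\<^sub>0 'k::field"
  shows "Poly_Mapping.map ((*) c) (x * y) = Poly_Mapping.map ((*) c) x * y"
    and "Poly_Mapping.map ((*) c) x * y = x * Poly_Mapping.map ((*) c) y"
proof -
  \<comment> \<open>Scaling by \<open>c\<close> is multiplication by \<open>c\<close> times the
    empty word, the \<open>0\<close> of the monoid of words. That element commutes with every
    monomial, hence is central.\<close>
  have *: "Poly_Mapping.single 0 c * x = x * Poly_Mapping.single 0 c" for x :: "'g list \<Rightarrow>\<^sub>0 'k"
  proof -
    have "Poly_Mapping.single 0 c * (\<Sum>w\<in>W. Poly_Mapping.single w (h w)) = (\<Sum>w\<in>W. Poly_Mapping.single w (h w)) * Poly_Mapping.single 0 c"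
      for W :: "'g list set" and h :: "'g list \<Rightarrow> 'k"
      by (simp add: sum_distrib_left sum_distrib_right mult_single mult.commute)
    then show ?thesis using sum_monomials[of x] by metis
  qed
  show "Poly_Mapping.map ((*) c) (x * y) = Poly_Mapping.map ((*) c) x * y"
    by (simp add: mult_map_scale_conv_mult mult.assoc)
  show "Poly_Mapping.map ((*) c) x * y = x * Poly_Mapping.map ((*) c) y"
    by (metis * mult_map_scale_conv_mult mult.assoc)
qed

lemma map_scale_closed:
  "x \<in> carrier (free_algebra G) \<Longrightarrow> Poly_Mapping.map ((*) c) x \<in> carrier (free_algebra G)"
  using keys_mult_lists(1)[of "Poly_Mapping.single [] c" G x]
  by (simp add: mult_map_scale_conv_mult zero_list_def)

text \<open>If \<open>x\<close> lies in a prime ideal, then so does \<open>(c x) r (c x) = x (c r) (c x)\<close> for every \<open>r\<close>;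
  thus prime ideals of the ring are ideals of the algebra.\<close>

lemma prime_ideal_scalar_closed:
  assumes "rng_prime_ideal I (free_algebra G)" "x \<in> I"
  shows "Poly_Mapping.map ((*) c) x \<in> I"
proof -
  interpret rng_prime_ideal I "free_algebra G" by fact
  have x: "x \<in> carrier (free_algebra G)" using assms(2) a_subset by blast
  have cx: "Poly_Mapping.map ((*) c) x \<in> carrier (free_algebra G)"
    using x by (rule map_scale_closed)
  have "Poly_Mapping.map ((*) c) x * r * Poly_Mapping.map ((*) c) x \<in> I"
    if r: "r \<in> carrier (free_algebra G)" for r
  proof -
    have "Poly_Mapping.map ((*) c) r * Poly_Mapping.map ((*) c) x \<in> carrier (free_algebra G)"
      using m_closed[OF map_scale_closed[OF r] cx] by simp
    then have "x * (Poly_Mapping.map ((*) c) r * Poly_Mapping.map ((*) c) x) \<in> I"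
      using I_r_closed[OF assms(2)] by simp
    then show ?thesis by (simp add: scalar_mult_assoc(2) mult.assoc)
  qed
  then show ?thesis using I_prime[OF cx cx] by simp
qed

lemma algebra_ideal_generated_rng_ideal:
  assumes "rng A" "X \<subseteq> carrier A" "\<And>c a. a \<in> carrier A \<Longrightarrow> c \<odot>\<^bsub>A\<^esub> a \<in> carrier A"
  shows "rng_ideal (algebra_ideal_generated A X) A"
proof -
  interpret rng A by fact
  define \<I> where "\<I> = {I. rng_ideal I A \<and> (\<forall>c. \<forall>a\<in>I. c \<odot>\<^bsub>A\<^esub> a \<in> I) \<and> X \<subseteq> I}"
  \<comment> \<open>The family is nonempty, so its intersection stays inside the carrier.\<close>
  have carr: "carrier A \<in> \<I>"
    using assms by (auto simp: \<I>_def m_closed intro: rng_idealI)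
  have I: "rng_ideal I A" if "I \<in> \<I>" for I using that by (auto simp: \<I>_def)
  have "rng_ideal (\<Inter>\<I>) A"
  proof (rule rng_idealI)
    show "\<Inter>\<I> \<subseteq> carrier A" using carr by blast
    show "\<zero>\<^bsub>A\<^esub> \<in> \<Inter>\<I>"
      using I by (simp add: additive_subgroup.zero_closed rng_ideal.axioms(1))
    show "x \<oplus>\<^bsub>A\<^esub> y \<in> \<Inter>\<I>" if "x \<in> \<Inter>\<I>" "y \<in> \<Inter>\<I>" for x y
      using that I by (simp add: additive_subgroup.a_closed rng_ideal.axioms(1))
    show "\<ominus>\<^bsub>A\<^esub> x \<in> \<Inter>\<I>" if "x \<in> \<Inter>\<I>" for x
      using that I abelian_group_axioms
      by (simp add: additive_subgroup.a_inv_closed rng_ideal.axioms(1))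
    show "x \<otimes>\<^bsub>A\<^esub> a \<in> \<Inter>\<I>" "a \<otimes>\<^bsub>A\<^esub> x \<in> \<Inter>\<I>" if "a \<in> \<Inter>\<I>" "x \<in> carrier A" for a x
      using that I by (simp_all add: rng_ideal.I_l_closed rng_ideal.I_r_closed)
  qed
  then show ?thesis by (simp add: algebra_ideal_generated_def \<I>_def)
qed

text \<open>\<open>N\<close> is generated as an ideal of the algebra, whereas primes are merely
  ideals of the ring. By \<open>prime_ideal_scalar_closed\<close> a prime ideal containing
  \<open>X\<close> competes in the intersection that defines \<open>N\<close>, so it contains
  \<open>N\<close>; the correspondence theorem does the rest.\<close>

lemma Spec_presented_algebra:
  fixes X :: "('g list \<Rightarrow>\<^sub>0 'k::field) set"
  assumes "X \<subseteq> carrier (free_algebra G)"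
  shows "\<exists>f. bij_betw f (Spec (presented_algebra G X)) {I \<in> Spec (free_algebra G). X \<subseteq> I} \<and>
    (\<forall>I \<in> Spec (presented_algebra G X). \<forall>J \<in> Spec (presented_algebra G X). f I \<subseteq> f J \<longleftrightarrow> I \<subseteq> J)"
proof -
  let ?F = "free_algebra G :: ('k, 'g list \<Rightarrow>\<^sub>0 'k) module"
  define N where "N = algebra_ideal_generated ?F X"
  have N: "rng_ideal N ?F"
    unfolding N_def using assms map_scale_closed
    by (intro algebra_ideal_generated_rng_ideal rng_free_algebra) (auto simp del: free_algebra_simps(1))
  interpret N: rng_ideal N ?F by (rule N)
  interpret rng_surj ?F "quotient_algebra ?F N" "\<lambda>x. N +>\<^bsub>?F\<^esub> x"
    by (rule quotient_algebra_rng_surj(1)[OF N])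
  have ker: "{x \<in> carrier ?F. N +>\<^bsub>?F\<^esub> x = \<zero>\<^bsub>quotient_algebra ?F N\<^esub>} = N"
    using quotient_algebra_rng_surj(2)[OF N] N.a_subset by blast
  have "N \<subseteq> I \<longleftrightarrow> X \<subseteq> I" if "I \<in> Spec ?F" for I
  proof
    have "X \<subseteq> N" by (auto simp: N_def algebra_ideal_generated_def)
    then show "X \<subseteq> I" if "N \<subseteq> I" using that by blast
    have prime: "rng_prime_ideal I ?F" using that by (simp add: Spec_def)
    then have "rng_ideal I ?F" by (rule rng_prime_ideal.axioms)
    then show "N \<subseteq> I" if "X \<subseteq> I"
      using that prime_ideal_scalar_closed[OF prime]
      by (auto simp: N_def algebra_ideal_generated_def)
  qed
  then have "{I \<in> Spec ?F. N \<subseteq> I} = {I \<in> Spec ?F. X \<subseteq> I}" by blast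
  then have bij: "bij_betw (\<lambda>J. {x \<in> carrier ?F. N +>\<^bsub>?F\<^esub> x \<in> J}) (Spec (presented_algebra G X))
      {I \<in> Spec ?F. X \<subseteq> I}"
    using Spec_preimage_bij unfolding ker presented_algebra_def N_def[symmetric] by simp
  show ?thesis
    by (intro exI conjI ballI, rule bij)
      (simp only: Spec_preimage_subset_iff presented_algebra_def N_def[symmetric])
qed

section \<open>Normal forms in Leavitt path algebras\<close>

lemma (in wf_digraph) lpa_rels_carrier:
  "lpa_rels G \<subseteq> carrier (free_algebra (lpa_gens G) :: ('k::field, _) module)"
proof -
  have diff: "Poly_Mapping.keys (f - g) \<subseteq> S"
    if "Poly_Mapping.keys f \<subseteq> S" "Poly_Mapping.keys g \<subseteq> S"
    for f g :: "('a, 'b) lpa_gen list \<Rightarrow>\<^sub>0 'k" and S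
  proof
    fix w assume "w \<in> Poly_Mapping.keys (f - g)"
    then have "w \<in> Poly_Mapping.keys f \<or> w \<in> Poly_Mapping.keys g"
      by (auto simp: in_keys_iff lookup_minus)
    then show "w \<in> S" using that by blast
  qed
  have sum: "Poly_Mapping.keys (\<Sum>e\<in>A. f e) \<subseteq> S"
    if "\<And>e. e \<in> A \<Longrightarrow> Poly_Mapping.keys (f e) \<subseteq> S"
    for f :: "'b \<Rightarrow> ('a, 'b) lpa_gen list \<Rightarrow>\<^sub>0 'k" and A S
    using that
    by (induction A rule: infinite_finite_induct) (auto intro!: subset_trans[OF keys_add])
  show ?thesis
    unfolding lpa_rels_def free_algebra_simps
    by (intro Un_least subsetI; elim CollectE exE conjE; hypsubst; intro CollectI diff sum)
      (auto simp: lpa_gens_def regular_vertex_def split: if_splits)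
qed

text \<open>The preimages in the free algebra of the algebra ideals of the Leavitt path algebra.
  Primeness is left out because the locale also serves for intersections and for the kernel of the
  representation, before anything is known about their primeness.\<close>

locale leavitt_ideal = wf_digraph E + rng_ideal I "free_algebra (lpa_gens E)"
  for E :: "('v, 'e) pre_digraph" and I :: "(('v, 'e) lpa_gen list \<Rightarrow>\<^sub>0 'k::field) set" +
  assumes scalar_closed: "x \<in> I \<Longrightarrow> Poly_Mapping.map ((*) c) x \<in> I"
    and rels: "lpa_rels E \<subseteq> I"
begin

section \<open>Computing with words modulo the ideal\<close>

abbreviation words :: "('v, 'e) lpa_gen list set" where
  "words \<equiv> lists (lpa_gens E)"

text \<open>The relations (V), (E1), (E2) and (CK1), on which the reduction rests, equate a word
  with a word or with zero. Rewriting thus never leaves single words, and congruence of words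
  together with \<open>null\<close> suffices.\<close>

definition weq :: "('v, 'e) lpa_gen list \<Rightarrow> ('v, 'e) lpa_gen list \<Rightarrow> bool" (infix \<open>\<sim>\<close> 50) where
  "u \<sim> v \<longleftrightarrow> (word u :: _ \<Rightarrow>\<^sub>0 'k) - word v \<in> I"

definition null :: "('v, 'e) lpa_gen list \<Rightarrow> bool" where
  "null w \<longleftrightarrow> (word w :: _ \<Rightarrow>\<^sub>0 'k) \<in> I"

text \<open>The word of the element \<open>a b*\<close>; the vertices at both ends make trivial paths nonempty words.\<close>

definition nf :: "'v \<Rightarrow> 'e list \<Rightarrow> 'e list \<Rightarrow> 'v \<Rightarrow> ('v, 'e) lpa_gen list" where
  "nf p a b q = Vertex p # map Edge a @ map Ghost (rev b) @ [Vertex q]"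

lemma gens_simps [simp]:
  "Vertex v \<in> lpa_gens E \<longleftrightarrow> v \<in> verts E"
  "Edge e \<in> lpa_gens E \<longleftrightarrow> e \<in> arcs E"
  "Ghost e \<in> lpa_gens E \<longleftrightarrow> e \<in> arcs E"
  by (auto simp: lpa_gens_def)

lemma map_words [simp]:
  "map Edge a \<in> words \<longleftrightarrow> set a \<subseteq> arcs E" "map Ghost a \<in> words \<longleftrightarrow> set a \<subseteq> arcs E"
  by (auto simp: in_lists_conv_set)

lemma mem_carrier: "x \<in> I \<Longrightarrow> Poly_Mapping.keys x \<subseteq> words - {[]}"
  using a_subset by auto

lemma zero_mem [simp]: "0 \<in> I"
  using additive_subgroup.zero_closed[OF additive_subgroup_axioms] by simp

lemma add_mem: "\<lbrakk>x \<in> I; y \<in> I\<rbrakk> \<Longrightarrow> x + y \<in> I"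
  using additive_subgroup.a_closed[OF additive_subgroup_axioms] by simp

lemma uminus_mem: "x \<in> I \<Longrightarrow> - x \<in> I"
  using additive_subgroup.a_inv_closed[OF additive_subgroup_axioms, of x]
    free_algebra_a_inv[of x "lpa_gens E"] mem_carrier[of x] by simp

lemma diff_mem: "\<lbrakk>x \<in> I; y \<in> I\<rbrakk> \<Longrightarrow> x - y \<in> I"
  using add_mem[of x "- y"] uminus_mem by simp

lemma sum_mem: "(\<And>i. i \<in> A \<Longrightarrow> f i \<in> I) \<Longrightarrow> sum f A \<in> I"
  by (induction A rule: infinite_finite_induct) (auto intro: add_mem)

lemma mult_mem:
  assumes "x \<in> I" "Poly_Mapping.keys y \<subseteq> words - {[]}"
  shows "x * y \<in> I" "y * x \<in> I"
  using assms I_l_closed[of x y] I_r_closed[of x y] by auto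

lemma keys_mult_words:
  "\<lbrakk>Poly_Mapping.keys x \<subseteq> words - {[]}; Poly_Mapping.keys y \<subseteq> words - {[]}\<rbrakk>
    \<Longrightarrow> Poly_Mapping.keys (x * y) \<subseteq> words - {[]}"
  by (intro keys_mult_lists) auto

lemma word_mult_mem:
  assumes "x \<in> I" "u \<in> words" "v \<in> words" shows "word u * x * word v \<in> I"
proof -
  \<comment> \<open>An empty context needs its own case: \<open>word [] = 1\<close> is not an
    element of the free non-unital algebra.\<close>
  have "word u * x \<in> I"
    using assms mult_mem(2)[of x "word u"] by (cases "u = []") (auto simp: word_Nil)
  then show ?thesis
    using assms mult_mem(1)[of "word u * x" "word v"] by (cases "v = []") (auto simp: word_Nil)
qed

lemma weq_refl [simp]: "u \<sim> u"
  by (simp add: weq_def)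

lemma weq_sym: "u \<sim> v \<Longrightarrow> v \<sim> u"
  unfolding weq_def using uminus_mem by fastforce

lemma weq_trans [trans]: "\<lbrakk>u \<sim> v; v \<sim> w\<rbrakk> \<Longrightarrow> u \<sim> w"
  unfolding weq_def using add_mem by fastforce

lemma weq_null: "u \<sim> v \<Longrightarrow> null u \<longleftrightarrow> null v"
  unfolding weq_def null_def
  using add_mem[of "word u - word v" "word v"] diff_mem[of "word u" "word u - word v"] by auto

lemma weq_null_trans [trans]: "\<lbrakk>u \<sim> v; null v\<rbrakk> \<Longrightarrow> null u"
  by (simp add: weq_null)

lemma weq_in: "\<lbrakk>u \<sim> v; a \<in> words; b \<in> words\<rbrakk> \<Longrightarrow> a @ u @ b \<sim> a @ v @ b"
  using word_mult_mem[of "word u - word v" a b]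
  by (simp add: weq_def left_diff_distrib right_diff_distrib word_mult)

lemma null_in: "\<lbrakk>null u; a \<in> words; b \<in> words\<rbrakk> \<Longrightarrow> null (a @ u @ b)"
  using word_mult_mem[of "word u" a b] by (simp add: null_def word_mult)

lemma weq_scale: "u \<sim> v \<Longrightarrow> Poly_Mapping.single u c - Poly_Mapping.single v c \<in> I"
  using scalar_closed[of "word u - word v" c]
  by (simp add: weq_def mult_map_scale_conv_mult right_diff_distrib mult_single)

lemma null_scale: "null u \<Longrightarrow> Poly_Mapping.single u c \<in> I"
  using scalar_closed[of "word u" c] by (simp add: null_def)

lemma rels':
  "\<lbrakk>v \<in> verts E; w \<in> verts E; v \<noteq> w\<rbrakk> \<Longrightarrow> null [Vertex v, Vertex w]"
  "v \<in> verts E \<Longrightarrow> [Vertex v, Vertex v] \<sim> [Vertex v]"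
  "e \<in> arcs E \<Longrightarrow> [Vertex (tail E e), Edge e] \<sim> [Edge e]"
  "e \<in> arcs E \<Longrightarrow> [Edge e, Vertex (head E e)] \<sim> [Edge e]"
  "e \<in> arcs E \<Longrightarrow> [Vertex (head E e), Ghost e] \<sim> [Ghost e]"
  "e \<in> arcs E \<Longrightarrow> [Ghost e, Vertex (tail E e)] \<sim> [Ghost e]"
  "\<lbrakk>e \<in> arcs E; f \<in> arcs E; e \<noteq> f\<rbrakk> \<Longrightarrow> null [Ghost e, Edge f]"
  "e \<in> arcs E \<Longrightarrow> [Ghost e, Edge e] \<sim> [Vertex (head E e)]"
proof -
  note R = rels[unfolded lpa_rels_def Un_subset_iff]
  show "null [Vertex v, Vertex w]" if "v \<in> verts E" "w \<in> verts E" "v \<noteq> w"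
    using that subsetD[OF R[THEN conjunct1, THEN conjunct1, THEN conjunct1, THEN conjunct1, THEN conjunct1, THEN conjunct1], of "word [Vertex v, Vertex w]"]
    unfolding null_def by force
  show "[Vertex v, Vertex v] \<sim> [Vertex v]" if "v \<in> verts E"
    using that unfolding weq_def by (intro subsetD[OF R[THEN conjunct1, THEN conjunct1, THEN conjunct1, THEN conjunct1, THEN conjunct1, THEN conjunct1]]) force
  show "[Vertex (tail E e), Edge e] \<sim> [Edge e]" if "e \<in> arcs E"
    using that unfolding weq_def by (intro subsetD[OF R[THEN conjunct1, THEN conjunct1, THEN conjunct1, THEN conjunct1, THEN conjunct1, THEN conjunct2]]) blast
  show "[Edge e, Vertex (head E e)] \<sim> [Edge e]" if "e \<in> arcs E"
    using that unfolding weq_def by (intro subsetD[OF R[THEN conjunct1, THEN conjunct1, THEN conjunct1, THEN conjunct1, THEN conjunct2]]) blast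
  show "[Vertex (head E e), Ghost e] \<sim> [Ghost e]" if "e \<in> arcs E"
    using that unfolding weq_def by (intro subsetD[OF R[THEN conjunct1, THEN conjunct1, THEN conjunct1, THEN conjunct2]]) blast
  show "[Ghost e, Vertex (tail E e)] \<sim> [Ghost e]" if "e \<in> arcs E"
    using that unfolding weq_def by (intro subsetD[OF R[THEN conjunct1, THEN conjunct1, THEN conjunct2]]) blast
  show "null [Ghost e, Edge f]" if "e \<in> arcs E" "f \<in> arcs E" "e \<noteq> f"
    using that subsetD[OF R[THEN conjunct1, THEN conjunct2], of "word [Ghost e, Edge f]"]
    unfolding null_def by force
  show "[Ghost e, Edge e] \<sim> [Vertex (head E e)]" if "e \<in> arcs E"
    using that unfolding weq_def by (intro subsetD[OF R[THEN conjunct1, THEN conjunct2]]) force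
qed

lemma null_inside:
  assumes "a \<in> words" "b \<in> words"
  shows "\<lbrakk>v \<in> verts E; w \<in> verts E; v \<noteq> w\<rbrakk> \<Longrightarrow> null (a @ Vertex v # Vertex w # b)"
    and "\<lbrakk>e \<in> arcs E; f \<in> arcs E; e \<noteq> f\<rbrakk> \<Longrightarrow> null (a @ Ghost e # Edge f # b)"
  using null_in[OF rels'(1) assms] null_in[OF rels'(7) assms] by simp_all

lemma weq_inside:
  assumes "a \<in> words" "b \<in> words"
  shows "v \<in> verts E \<Longrightarrow> a @ Vertex v # Vertex v # b \<sim> a @ Vertex v # b"
    and "e \<in> arcs E \<Longrightarrow> a @ Vertex (tail E e) # Edge e # b \<sim> a @ Edge e # b"
    and "e \<in> arcs E \<Longrightarrow> a @ Edge e # Vertex (head E e) # b \<sim> a @ Edge e # b"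
    and "e \<in> arcs E \<Longrightarrow> a @ Vertex (head E e) # Ghost e # b \<sim> a @ Ghost e # b"
    and "e \<in> arcs E \<Longrightarrow> a @ Ghost e # Vertex (tail E e) # b \<sim> a @ Ghost e # b"
    and "e \<in> arcs E \<Longrightarrow> a @ Ghost e # Edge e # b \<sim> a @ Vertex (head E e) # b"
  using weq_in[OF rels'(2) assms] weq_in[OF rels'(3) assms] weq_in[OF rels'(4) assms]
    weq_in[OF rels'(5) assms] weq_in[OF rels'(6) assms] weq_in[OF rels'(8) assms] by simp_all

section \<open>Cancelling paths against ghost paths\<close>

lemma awalk_arcs: "awalk p a q \<Longrightarrow> set a \<subseteq> arcs E"
  by (auto simp: awalk_def)

lemma awalk_verts: "awalk p a q \<Longrightarrow> p \<in> verts E \<and> q \<in> verts E"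
  using awalk_hd_in_verts awalk_last_in_verts by blast

text \<open>In algebraic notation \<open>(c a)* (c b) = a* b\<close>. The pair \<open>e* e\<close>
  of the first edge of \<open>c\<close> is innermost and becomes the vertex \<open>head E e\<close>
  by (CK1), which exposes the next pair. Keeping a vertex in the middle makes the word nonempty even
  for trivial paths.\<close>

lemma strip:
  assumes "awalk p c q" "set a \<subseteq> arcs E" "set b \<subseteq> arcs E"
  shows "map Ghost (rev (c @ a)) @ Vertex p # map Edge (c @ b)
    \<sim> map Ghost (rev a) @ Vertex q # map Edge b"
  using assms
proof (induction c arbitrary: p)
  case Nil
  then show ?case by (simp add: awalk_Nil_iff)
next
  case (Cons e c)
  then have e: "e \<in> arcs E" "p = tail E e" and c: "awalk (head E e) c q"
    by (auto simp: awalk_Cons_iff)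
  let ?X = "map Ghost (rev (c @ a))" and ?Y = "map Edge (c @ b)"
  have XY: "?X \<in> words" "?Y \<in> words" using Cons.prems awalk_arcs[OF c] by (auto simp flip: map_append)
  have "map Ghost (rev ((e # c) @ a)) @ Vertex p # map Edge ((e # c) @ b)
      = ?X @ Ghost e # Vertex (tail E e) # Edge e # ?Y" by (simp add: e)
  also have "\<dots> \<sim> ?X @ Ghost e # Edge e # ?Y"
    using XY e by (intro weq_inside) auto
  also have "\<dots> \<sim> ?X @ Vertex (head E e) # ?Y"
    using XY e by (intro weq_inside) auto
  also have "\<dots> \<sim> map Ghost (rev a) @ Vertex q # map Edge b"
    using Cons.IH[OF c] Cons.prems by simp
  finally show ?case .
qed

text \<open>Once the common prefix is cancelled by \<open>strip\<close>, two distinct edges meet,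
  and \<open>e* f\<close> vanishes by (CK1).\<close>

lemma parallel_null:
  assumes "awalk p a q" "awalk p b r" "a \<parallel> b"
  shows "null (map Ghost (rev a) @ Vertex p # map Edge b)"
proof -
  obtain c e a' f b' where ef: "e \<noteq> f" and a: "a = c @ e # a'" and b: "b = c @ f # b'"
    using parallel_decomp[OF assms(3)] by metis
  obtain s where c: "awalk p c s" and ea: "awalk s (e # a') q"
    using assms(1) by (auto simp: a awalk_append_iff)
  have fb: "awalk s (f # b') r"
    using assms(2) c by (auto simp: b awalk_append_iff awlast_if_cas dest: awalk_ends_eqD)
  have e: "e \<in> arcs E" "s = tail E e" "set a' \<subseteq> arcs E" using awalk_arcs[OF ea] ea by (auto simp: awalk_Cons_iff)
  have f: "f \<in> arcs E" "set b' \<subseteq> arcs E" using awalk_arcs[OF fb] by auto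
  have "map Ghost (rev (c @ e # a')) @ Vertex p # map Edge (c @ f # b')
      \<sim> map Ghost (rev (e # a')) @ Vertex s # map Edge (f # b')"
    using e f by (intro strip[OF c]) auto
  also have "\<dots> = map Ghost (rev a') @ Ghost e # Vertex (tail E e) # Edge f # map Edge b'"
    by (simp add: e)
  also have "\<dots> \<sim> map Ghost (rev a') @ Ghost e # Edge f # map Edge b'"
    using e f by (intro weq_inside) auto
  also have "null \<dots>"
    using e f ef by (intro null_inside) auto
  finally show ?thesis by (simp only: a b)
qed

text \<open>Modulo \<open>I\<close> the vertex \<open>q\<close> equals \<open>c* p c\<close>, a
  multiple of \<open>p\<close>.\<close>

lemma vertex_hereditary: "\<lbrakk>awalk p c q; null [Vertex p]\<rbrakk> \<Longrightarrow> null [Vertex q]"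
  using strip[of p c q "[]" "[]"] null_in[of "[Vertex p]" "map Ghost (rev c)" "map Edge c"] awalk_arcs[of p c q]
  by (auto dest: weq_null)

lemma path_end:
  assumes "awalk p a q" "b \<in> words"
  shows "Vertex p # map Edge a @ Vertex q # b \<sim> Vertex p # map Edge a @ b"
proof (cases a rule: rev_cases)
  case Nil
  then show ?thesis using assms weq_inside(1)[of "[]" b p] by (auto simp: awalk_Nil_iff)
next
  case (snoc a' e)
  then have e: "q = head E e" "e \<in> arcs E" "set a' \<subseteq> arcs E" "p \<in> verts E"
    using assms awalk_verts[OF assms(1)] by (auto simp: awalk_append_iff awalk_Cons_iff awalk_Nil_iff dest: awalk_arcs)
  then show ?thesis using assms weq_inside(3)[of "Vertex p # map Edge a'" b e]
    by (auto simp: snoc)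
qed

lemma null_nf:
  assumes "awalk p a r" "awalk q b r" "null [Vertex r]" shows "null (nf p a b q)"
proof -
  have "nf p a b q \<sim> (Vertex p # map Edge a) @ [Vertex r] @ map Ghost (rev b) @ [Vertex q]"
    using path_end[OF assms(1), of "map Ghost (rev b) @ [Vertex q]"] awalk_arcs[OF assms(2)]
      awalk_verts[OF assms(2)]
    by (simp add: nf_def weq_sym)
  moreover have "null \<dots>"
    using assms(3) awalk_arcs[OF assms(1)] awalk_arcs[OF assms(2)]
      awalk_verts[OF assms(1)] awalk_verts[OF assms(2)] by (intro null_in) auto
  ultimately show ?thesis by (simp add: weq_null)
qed

section \<open>Reduction of words to normal form\<close>

definition reducible :: "('v, 'e) lpa_gen list \<Rightarrow> bool" where
  "reducible w \<longleftrightarrow> null w \<or> (\<exists>p a b q r. awalk p a r \<and> awalk q b r \<and> w \<sim> nf p a b q)"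

lemma reducible_weq: "\<lbrakk>u \<sim> v; reducible v\<rbrakk> \<Longrightarrow> reducible u"
  unfolding reducible_def using weq_null weq_trans by blast

lemma reducible_nf: "\<lbrakk>awalk p a r; awalk q b r\<rbrakk> \<Longrightarrow> reducible (nf p a b q)"
  unfolding reducible_def using weq_refl by blast

lemma reducible_null: "null w \<Longrightarrow> reducible w"
  by (simp add: reducible_def)

text \<open>A generator on the left of \<open>a b*\<close> acts as follows. A vertex is absorbed, an
  edge prolongs \<open>a\<close>, and a ghost edge cancels the first edge of \<open>a\<close> or, if
  \<open>a\<close> is trivial, prolongs \<open>b\<close> because \<open>e* b* = (b e)*\<close>.
  Every mismatch of vertices or edges gives zero.\<close>

lemma reducible_Cons_nf:
  assumes g: "g \<in> lpa_gens E" and a: "awalk p a r" and b: "awalk q b r"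
  shows "reducible (g # nf p a b q)"
proof -
  define t where "t = map Edge a @ map Ghost (rev b) @ [Vertex q]"
  have t: "t \<in> words" and p: "p \<in> verts E" and nf: "nf p a b q = Vertex p # t"
    using awalk_arcs[OF a] awalk_arcs[OF b] awalk_verts[OF a] awalk_verts[OF b]
    by (auto simp: t_def nf_def)
  show ?thesis
  proof (cases g)
    case (Vertex v)
    show ?thesis
    proof (cases "v = p")
      case True
      then have "g # nf p a b q \<sim> nf p a b q"
        using weq_inside(1)[of "[]" t p] t p by (simp add: nf Vertex)
      then show ?thesis using reducible_weq reducible_nf[OF a b] by blast
    next
      case False
      then show ?thesis
        using null_inside(1)[of "[]" t v p] t p g by (simp add: nf Vertex reducible_null)
    qed
  next
    case (Edge e)
    then have e: "e \<in> arcs E" using g by simp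
    show ?thesis
    proof (cases "head E e = p")
      case True
      have "g # nf p a b q \<sim> Edge e # t"
        using weq_inside(3)[of "[]" t e] t e True by (simp add: nf Edge)
      also have "\<dots> \<sim> nf (tail E e) (e # a) b q"
        using weq_inside(2)[of "[]" t e] t e by (simp add: nf_def t_def weq_sym)
      finally show ?thesis
        using reducible_weq reducible_nf[of "tail E e" "e # a" r q b] a b e True
        by (auto simp: awalk_Cons_iff)
    next
      case False
      have "g # nf p a b q \<sim> [Edge e] @ Vertex (head E e) # Vertex p # t"
        using weq_inside(3)[of "[]" "Vertex p # t" e] t e p by (simp add: nf Edge weq_sym)
      moreover have "null \<dots>"
        using False t e p by (intro null_inside) auto
      ultimately show ?thesis by (auto intro: reducible_null simp: weq_null)
    qed
  next
    case (Ghost e)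
    then have e: "e \<in> arcs E" using g by simp
    show ?thesis
    proof (cases "tail E e = p")
      case False
      have "g # nf p a b q \<sim> [Ghost e] @ Vertex (tail E e) # Vertex p # t"
        using weq_inside(5)[of "[]" "Vertex p # t" e] t e p by (simp add: nf Ghost weq_sym)
      moreover have "null \<dots>"
        using False t e p by (intro null_inside) auto
      ultimately show ?thesis by (auto intro: reducible_null simp: weq_null)
    next
      case True
      have "g # nf p a b q \<sim> Ghost e # t"
        using weq_inside(5)[of "[]" t e] t e True by (simp add: nf Ghost)
      moreover have "reducible (Ghost e # t)"
      proof (cases a)
        case Nil
        have "Ghost e # t \<sim> nf (head E e) [] (b @ [e]) q"
          using weq_inside(4)[of "[]" t e] t e by (simp add: nf_def t_def Nil weq_sym)
        moreover have "awalk q (b @ [e]) (head E e)"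
          using a b True e by (auto simp: Nil awalk_Nil_iff awalk_append_iff awalk_Cons_iff
              dest: awalk_ends_eqD)
        moreover have "awalk (head E e) [] (head E e)" using e by (simp add: awalk_Nil_iff)
        ultimately show ?thesis using reducible_weq reducible_nf by blast
      next
        case (Cons f a')
        then have f: "f \<in> arcs E" "awalk (head E f) a' r" "tail E f = p"
          using a by (auto simp: awalk_Cons_iff)
        let ?t = "map Edge a' @ map Ghost (rev b) @ [Vertex q]"
        have t': "?t \<in> words" using t by (simp add: t_def Cons)
        show ?thesis
        proof (cases "e = f")
          case True
          then have "Ghost e # t \<sim> nf (head E e) a' b q"
            using weq_inside(6)[of "[]" ?t e] t' e by (simp add: nf_def t_def Cons)
          then show ?thesis using reducible_weq reducible_nf f b True by blast
        next
          case False
          then show ?thesis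
            using null_inside(2)[of "[]" ?t e f] t' e f by (simp add: t_def Cons reducible_null)
        qed
      qed
      ultimately show ?thesis by (rule reducible_weq)
    qed
  qed
qed

lemma reducible_Cons:
  assumes "g \<in> lpa_gens E" "w \<in> words" "reducible w" shows "reducible (g # w)"
proof (cases "null w")
  case True
  then show ?thesis using null_in[of w "[g]" "[]"] assms by (simp add: reducible_null)
next
  case False
  then obtain p a b q r where w: "awalk p a r" "awalk q b r" "w \<sim> nf p a b q"
    using assms(3) by (auto simp: reducible_def)
  then have "g # w \<sim> g # nf p a b q"
    using weq_in[OF w(3), of "[g]" "[]"] assms(1) by simp
  then show ?thesis using reducible_weq reducible_Cons_nf[OF assms(1) w(1,2)] by blast
qed

lemma reducible_word:
  assumes "w \<in> words" "w \<noteq> []" shows "reducible w"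
proof -
  have *: "reducible (u @ [Vertex v])" if "u \<in> words" "v \<in> verts E" for u v
    using that
  proof (induction u)
    case Nil
    have "[Vertex v] \<sim> nf v [] [] v"
      using weq_inside(1)[of "[]" "[]" v] Nil by (simp add: nf_def weq_sym)
    moreover have "awalk v [] v" using Nil by (simp add: awalk_Nil_iff)
    ultimately show ?case using reducible_weq reducible_nf by (metis append_Nil)
  next
    case (Cons g u)
    then show ?case using reducible_Cons[of g "u @ [Vertex v]"] by simp
  qed
  obtain u g where w: "w = u @ [g]" using assms(2) by (metis rev_exhaust)
  \<comment> \<open>The induction builds words from right to left and must start at a vertex. Each
    generator absorbs a suitable vertex on its right, so one can be appended.\<close>
  obtain v where "v \<in> verts E" "w \<sim> w @ [Vertex v]"
  proof (cases g)
    case (Vertex v)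
    then show thesis using that[of v] weq_inside(1)[of u "[]" v] assms(1) by (simp add: w weq_sym)
  next
    case (Edge e)
    then show thesis using that[of "head E e"] weq_inside(3)[of u "[]" e] assms(1)
      by (simp add: w weq_sym)
  next
    case (Ghost e)
    then show thesis using that[of "tail E e"] weq_inside(5)[of u "[]" e] assms(1)
      by (simp add: w weq_sym)
  qed
  then show ?thesis using *[OF assms(1)] reducible_weq by blast
qed

definition normal_forms :: "('v, 'e) lpa_gen list set" where
  "normal_forms = {nf p a b q | p a b q r. awalk p a r \<and> awalk q b r \<and> \<not> null [Vertex r]}"

lemma ex_normal_form:
  assumes "Poly_Mapping.keys x \<subseteq> words - {[]}"
  obtains y where "Poly_Mapping.keys y \<subseteq> normal_forms" "x - y \<in> I"
proof -
  have single: "\<exists>y. Poly_Mapping.keys y \<subseteq> normal_forms \<and> Poly_Mapping.single w c - y \<in> I"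
    if w: "w \<in> words" "w \<noteq> []" for w c
  proof (cases "null w")
    case True
    then show ?thesis by (intro exI[of _ 0]) (simp add: null_scale)
  next
    case False
    then obtain p a b q r where nf: "awalk p a r" "awalk q b r" "w \<sim> nf p a b q"
      using reducible_word[OF w] False by (auto simp: reducible_def)
    then have "\<not> null [Vertex r]" using null_nf weq_null False by blast
    then have "Poly_Mapping.keys (Poly_Mapping.single (nf p a b q) c) \<subseteq> normal_forms"
      using nf unfolding normal_forms_def by (simp; blast)
    then show ?thesis using weq_scale[OF nf(3)] by blast
  qed
  have "\<exists>y. Poly_Mapping.keys y \<subseteq> normal_forms
      \<and> (\<Sum>w\<in>W. Poly_Mapping.single w (h w)) - y \<in> I"
    if "finite W" "W \<subseteq> words - {[]}" for W h
    using that
  proof (induction W)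
    case empty
    then show ?case by (intro exI[of _ 0]) simp
  next
    case (insert w W)
    obtain y where y: "Poly_Mapping.keys y \<subseteq> normal_forms"
      "(\<Sum>w\<in>W. Poly_Mapping.single w (h w)) - y \<in> I" using insert by auto
    obtain z where z: "Poly_Mapping.keys z \<subseteq> normal_forms" "Poly_Mapping.single w (h w) - z \<in> I"
      using single[of w "h w"] insert.prems by blast
    have "Poly_Mapping.keys (z + y) \<subseteq> normal_forms" using y z keys_add[of z y] by blast
    moreover have "(Poly_Mapping.single w (h w) - z) + ((\<Sum>w\<in>W. Poly_Mapping.single w (h w)) - y) \<in> I"
      using y z by (intro add_mem)
    ultimately show ?case using insert.hyps by (intro exI[of _ "z + y"]) (simp add: algebra_simps)
  qed
  from this[of "Poly_Mapping.keys x" "Poly_Mapping.lookup x"] show thesis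
    using assms that by (auto simp flip: sum_monomials)
qed

end

section \<open>Ideals of Leavitt path algebras and their vertices\<close>

text \<open>\<open>fresh\<close> says that a vertex emitting one edge with head outside
  \<open>I\<close> emits infinitely many of them. It is the absence of regular vertices in the form
  that is meaningful modulo \<open>I\<close>.\<close>

locale fresh_leavitt_ideal = leavitt_ideal E I
  for E :: "('v, 'e) pre_digraph" and I :: "(('v, 'e) lpa_gen list \<Rightarrow>\<^sub>0 'k::field) set" +
  assumes acyclic: "awalk p a p \<Longrightarrow> a = []"
    and fresh: "\<lbrakk>finite S; e \<in> arcs E; \<not> null [Vertex (head E e)]\<rbrakk>
      \<Longrightarrow> \<exists>f \<in> arcs E - S. tail E f = tail E e \<and> \<not> null [Vertex (head E f)]"
begin

lemma nf_null_if_head_differs: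
  assumes a: "awalk p a r" "awalk p1 a1 r1" and b: "awalk q b r" and v: "v \<in> words"
    and diff: "p \<noteq> p1 \<or> a \<parallel> a1"
  shows "null (map Ghost (rev a1) @ Vertex p1 # nf p a b q @ v)"
proof (cases "p = p1")
  case False
  then show ?thesis
    using awalk_arcs[OF a(1)] awalk_arcs[OF a(2)] awalk_arcs[OF b] awalk_verts[OF a(1)]
      awalk_verts[OF a(2)] awalk_verts[OF b] v
    unfolding nf_def append_Cons by (intro null_inside) auto
next
  case True
  let ?v = "map Ghost (rev b) @ Vertex q # v"
  have v': "?v \<in> words" using awalk_arcs[OF b] awalk_verts[OF b] v by auto
  have "map Ghost (rev a1) @ Vertex p1 # nf p a b q @ v
      \<sim> map Ghost (rev a1) @ Vertex p # map Edge a @ ?v"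
    using v' awalk_arcs[OF a(1)] awalk_arcs[OF a(2)] awalk_verts[OF a(1)] True
      weq_inside(1)[of "map Ghost (rev a1)" "map Edge a @ ?v" p] by (simp add: nf_def)
  also have "null \<dots>"
    using null_in[OF parallel_null[OF a(2) a(1)[unfolded True]], of "[]" ?v] v' diff True
    by (simp add: parallel_commute)
  finally show ?thesis .
qed

text \<open>The prolongation \<open>c\<close> can be arbitrary because \<open>b\<close> and
  \<open>b1\<close> already diverge before it is reached. In \<open>isolate_term\<close> it is the
  path \<open>d\<close> that the left factor requires.\<close>

lemma nf_null_if_tail_differs:
  assumes a: "awalk p a r" and b: "awalk q b r" "awalk q1 b1 r1" and u: "u \<in> words"
    and c: "set c \<subseteq> arcs E" and diff: "q \<noteq> q1 \<or> b \<parallel> b1"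
  shows "null (u @ nf p a b q @ Vertex q1 # map Edge (b1 @ c))"
proof (cases "q = q1")
  case False
  then have "null ((u @ Vertex p # map Edge a @ map Ghost (rev b)) @ Vertex q # Vertex q1 # map Edge (b1 @ c))"
    using awalk_arcs[OF b(1)] awalk_arcs[OF b(2)] awalk_arcs[OF a] awalk_verts[OF b(1)]
      awalk_verts[OF b(2)] awalk_verts[OF a] u c
    by (intro null_inside) (auto simp flip: map_append)
  then show ?thesis by (simp add: nf_def)
next
  case True
  let ?u = "u @ Vertex p # map Edge a"
  have u': "?u \<in> words" using awalk_arcs[OF a] awalk_verts[OF a] u by auto
  have "u @ nf p a b q @ Vertex q1 # map Edge (b1 @ c)
      \<sim> ?u @ (map Ghost (rev b) @ Vertex q # map Edge b1) @ map Edge c"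
    using u' awalk_arcs[OF b(1)] awalk_arcs[OF b(2)] awalk_verts[OF b(1)] True c
      weq_inside(1)[of "?u @ map Ghost (rev b)" "map Edge (b1 @ c)" q] by (simp add: nf_def)
  also have "null \<dots>"
    using parallel_null[OF b(1) b(2)[folded True]] diff True u' c
    by (intro null_in) auto
  finally show ?thesis .
qed

text \<open>Modulo \<open>I\<close> the product is
  \<open>d* (a* a) (b* b) d = d* d = r\<close>.\<close>

lemma nf_cancel:
  assumes a: "awalk p a q" and b: "awalk p' b q" and d: "awalk q d r"
  shows "map Ghost (rev (a @ d)) @ Vertex p # nf p a b p' @ Vertex p' # map Edge (b @ d) \<sim> [Vertex r]"
proof -
  note arcs = awalk_arcs[OF a] awalk_arcs[OF b] awalk_arcs[OF d]
  note verts = awalk_verts[OF a] awalk_verts[OF b] awalk_verts[OF d]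
  let ?v = "map Ghost (rev b) @ Vertex p' # Vertex p' # map Edge (b @ d)"
  have "map Ghost (rev (a @ d)) @ Vertex p # Vertex p # map Edge a @ ?v
      \<sim> map Ghost (rev (a @ d)) @ Vertex p # map Edge a @ ?v"
    using arcs verts by (intro weq_inside) auto
  also have "\<dots> \<sim> (map Ghost (rev d) @ [Vertex q]) @ ?v"
    using weq_in[OF strip[OF a, of d "[]"], of "[]" ?v] arcs verts by simp
  also have "\<dots> = (map Ghost (rev d) @ Vertex q # map Ghost (rev b)) @ Vertex p' # Vertex p' # map Edge (b @ d)"
    by simp
  also have "\<dots> \<sim> (map Ghost (rev d) @ Vertex q # map Ghost (rev b)) @ Vertex p' # map Edge (b @ d)"
    using arcs verts by (intro weq_inside) auto
  also have "\<dots> \<sim> map Ghost (rev d) @ Vertex q # Vertex q # map Edge d"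
    using weq_in[OF strip[OF b, of "[]" d], of "map Ghost (rev d) @ [Vertex q]" "[]"] arcs verts by simp
  also have "\<dots> \<sim> map Ghost (rev d) @ Vertex q # map Edge d"
    using arcs verts by (intro weq_inside) auto
  also have "\<dots> \<sim> [Vertex r]"
    using strip[OF d, of "[]" "[]"] by simp
  finally show ?thesis by (simp add: nf_def)
qed

text \<open>
  Multiplying by \<open>(a\<^sub>1 d)*\<close> on the left and by \<open>b\<^sub>1 d\<close> on the right isolates the term \<open>a\<^sub>1 b\<^sub>1*\<close>:
  since \<open>a\<^sub>1\<close> has minimal length and the edge \<open>d\<close> does not occur in \<open>y\<close>, only terms \<open>a\<^sub>1 b*\<close>
  survive on the left. On the right, \<open>b\<close> and \<open>b\<^sub>1\<close> have the same endpoints, so by acyclicity they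
  are equal if one is a prefix of the other. If no admissible edge \<open>d\<close> starts at the end of
  \<open>a\<^sub>1\<close>, then no longer path extending \<open>a\<^sub>1\<close> occurs in \<open>y\<close>, and \<open>d\<close> can be empty.
\<close>

lemma isolate_term:
  assumes y: "Poly_Mapping.keys y \<subseteq> normal_forms" "y \<noteq> 0"
  obtains a b r where "Poly_Mapping.keys a \<subseteq> words - {[]}" "Poly_Mapping.keys b \<subseteq> words - {[]}"
    "r \<in> verts E" "\<not> null [Vertex r]" "a * y * b - word [Vertex r] \<in> I"
proof -
  \<comment> \<open>The tuples keep the common end \<open>r\<close> of the two paths, which cannot
    be read off the word directly.\<close>
  define T where "T = {(p, a, b, q, r). nf p a b q \<in> Poly_Mapping.keys y \<and> awalk p a r \<and> awalk q b r
    \<and> \<not> null [Vertex r]}"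
  have T_ex: "\<exists>p a b q r. w = nf p a b q \<and> (p, a, b, q, r) \<in> T" if w: "w \<in> Poly_Mapping.keys y" for w
  proof -
    obtain p a b q r where "w = nf p a b q" "awalk p a r" "awalk q b r" "\<not> null [Vertex r]"
      using w y(1) unfolding normal_forms_def by blast
    then show ?thesis using w unfolding T_def by blast
  qed
  obtain w where "w \<in> Poly_Mapping.keys y" using y(2) by fastforce
  then obtain t0 where "t0 \<in> T" using T_ex by blast
  define len :: "'v \<times> 'e list \<times> 'e list \<times> 'v \<times> 'v \<Rightarrow> nat" where "len = (\<lambda>(p, a, b, q, r). length a)"
  obtain t where "t \<in> T" "\<forall>t'. t' \<in> T \<longrightarrow> len t \<le> len t'"
    using ex_has_least_nat[of "\<lambda>t. t \<in> T" t0 len] \<open>t0 \<in> T\<close> by blast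
  then obtain p1 a1 b1 q1 r1 where t: "(p1, a1, b1, q1, r1) \<in> T"
    and min: "\<And>p a b q r. (p, a, b, q, r) \<in> T \<Longrightarrow> length a1 \<le> length a"
    by (cases t) (force simp: len_def)
  have a1: "awalk p1 a1 r1" and b1: "awalk q1 b1 r1" and r1: "\<not> null [Vertex r1]"
    and key1: "nf p1 a1 b1 q1 \<in> Poly_Mapping.keys y"
    using t by (auto simp: T_def)
  obtain d r where d: "awalk r1 d r" and r: "\<not> null [Vertex r]"
    and d_fresh: "\<And>a b q r'. (p1, a, b, q, r') \<in> T \<Longrightarrow> a \<noteq> a1 \<Longrightarrow> a \<parallel> a1 @ d"
  proof (cases "\<exists>e \<in> arcs E. tail E e = r1 \<and> \<not> null [Vertex (head E e)]")
    case True
    \<comment> \<open>The finitely many edges occurring unstarred in \<open>y\<close>. An edge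
      outside \<open>S\<close> lies on none of the paths \<open>a\<close>.\<close>
    define S where "S = Edge -` (\<Union>w\<in>Poly_Mapping.keys y. set w)"
    have "finite S" unfolding S_def by (intro finite_vimageI) (auto simp: inj_on_def)
    then obtain e where e: "e \<in> arcs E" "e \<notin> S" "tail E e = r1" "\<not> null [Vertex (head E e)]"
      using True fresh by blast
    show thesis
    proof (rule that)
      show "awalk r1 [e] (head E e)" using e awalk_verts[OF a1] by (auto simp: awalk_Cons_iff awalk_Nil_iff)
      show "\<not> null [Vertex (head E e)]" by fact
      fix a b q r' assume a: "(p1, a, b, q, r') \<in> T" "a \<noteq> a1"
      then have "e \<notin> set a" using e(2) by (force simp: T_def S_def nf_def)
      then have "\<not> prefix (a1 @ [e]) a" by (auto simp: prefix_def)
      moreover have "\<not> prefix a (a1 @ [e])"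
      proof
        assume "prefix a (a1 @ [e])"
        then have "prefix a a1" using \<open>e \<notin> set a\<close> by (auto simp: prefix_snoc)
        then show False using min[OF a(1)] a(2) by (auto simp: prefix_def)
      qed
      ultimately show "a \<parallel> a1 @ [e]" by blast
    qed
  next
    case False
    show thesis
    proof (rule that)
      show "awalk r1 [] r1" using awalk_verts[OF a1] by (simp add: awalk_Nil_iff)
      show "\<not> null [Vertex r1]" by fact
      fix a b q r' assume a: "(p1, a, b, q, r') \<in> T" "a \<noteq> a1"
      have "\<not> prefix a1 a"
      proof
        assume "prefix a1 a"
        then obtain e c where ec: "a = a1 @ e # c" using a(2) by (metis append_Nil2 neq_Nil_conv prefix_def)
        then have "e \<in> arcs E" "tail E e = r1" "awalk (head E e) c r'" "\<not> null [Vertex r']"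
          using a(1) a1 by (auto simp: T_def awalk_append_iff awalk_Cons_iff dest: awalk_ends_eqD)
        then show False using False vertex_hereditary by blast
      qed
      moreover have "\<not> prefix a a1" using min[OF a(1)] a(2) by (auto simp: prefix_def)
      ultimately show "a \<parallel> a1 @ []" by auto
    qed
  qed
  define u where "u = map Ghost (rev (a1 @ d)) @ [Vertex p1]"
  define v where "v = Vertex q1 # map Edge (b1 @ d)"
  have uv: "u \<in> words" "u \<noteq> []" "v \<in> words" "v \<noteq> []"
    using awalk_arcs[OF a1] awalk_arcs[OF b1] awalk_arcs[OF d] awalk_verts[OF a1] awalk_verts[OF b1]
    by (auto simp: u_def v_def simp flip: map_append)
  have a1d: "awalk p1 (a1 @ d) r" using a1 d by (auto intro: awalk_appendI)
  have null_other: "null (u @ w @ v)" if w: "w \<in> Poly_Mapping.keys y" "w \<noteq> nf p1 a1 b1 q1" for w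
  proof -
    obtain p a b q s where w_eq: "w = nf p a b q" and T: "(p, a, b, q, s) \<in> T"
      using T_ex[OF w(1)] by blast
    then have a: "awalk p a s" and b: "awalk q b s" by (auto simp: T_def)
    consider "p \<noteq> p1 \<or> a \<parallel> a1 @ d" | "p = p1" "a = a1" using d_fresh T by blast
    then show ?thesis
    proof cases
      case 1
      then show ?thesis
        using nf_null_if_head_differs[OF a a1d b uv(3)] by (simp add: u_def w_eq)
    next
      case 2
      then have s: "s = r1" using a a1 awalk_ends_eqD by (metis awalk_def awlast_if_cas)
      have "q \<noteq> q1 \<or> b \<parallel> b1"
      proof (rule ccontr)
        assume *: "\<not> (q \<noteq> q1 \<or> b \<parallel> b1)"
        then have "q = q1" by blast
        have aux: "c = c'" if c: "prefix c c'" "awalk q1 c r1" "awalk q1 c' r1" for c c'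
        proof -
          obtain z where z: "c' = c @ z" using c(1) by (auto simp: prefix_def)
          then have "awalk r1 z r1" using c(2,3)
            by (auto simp: awalk_append_iff awlast_if_cas dest: awalk_ends_eqD)
          then show ?thesis using acyclic z by auto
        qed
        have "b = b1" using * aux b b1 s by (metis parallel_def)
        then show False using w(2) w_eq 2 \<open>q = q1\<close> by simp
      qed
      then show ?thesis
        using nf_null_if_tail_differs[OF a b b1 uv(1) awalk_arcs[OF d]] by (simp add: v_def w_eq)
    qed
  qed
  have cancel: "u @ nf p1 a1 b1 q1 @ v \<sim> [Vertex r]"
    using nf_cancel[OF a1 b1 d] by (simp add: u_def v_def)
  define c where "c = Poly_Mapping.lookup y (nf p1 a1 b1 q1)"
  have c: "c \<noteq> 0" using key1 by (simp add: c_def in_keys_iff)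
  \<comment> \<open>Dividing by \<open>c\<close> gives the isolated term coefficient 1, so that the
    product is a vertex and not a multiple of one.\<close>
  define h where "h w = Poly_Mapping.single (u @ w @ v) (Poly_Mapping.lookup y w / c)" for w
  have "Poly_Mapping.single u (1 / c) * (\<Sum>w\<in>W. Poly_Mapping.single w (Poly_Mapping.lookup y w)) * word v
      = sum h W" for W
    by (simp add: h_def sum_distrib_left sum_distrib_right mult_single plus_list_def)
  from this[of "Poly_Mapping.keys y"]
  have "Poly_Mapping.single u (1 / c) * y * word v = (\<Sum>w\<in>Poly_Mapping.keys y. h w)"
    by (simp flip: sum_monomials)
  also have "\<dots> = h (nf p1 a1 b1 q1) + (\<Sum>w\<in>Poly_Mapping.keys y - {nf p1 a1 b1 q1}. h w)"
    using key1 by (simp add: sum.remove)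
  finally have eq: "Poly_Mapping.single u (1 / c) * y * word v - word [Vertex r]
      = (word (u @ nf p1 a1 b1 q1 @ v) - word [Vertex r])
        + (\<Sum>w\<in>Poly_Mapping.keys y - {nf p1 a1 b1 q1}. h w)"
    using c by (simp add: h_def c_def[symmetric])
  have "Poly_Mapping.single u (1 / c) * y * word v - word [Vertex r] \<in> I"
    unfolding eq using cancel null_other
    by (intro add_mem sum_mem) (auto simp: h_def weq_def intro: null_scale)
  then show thesis
    using uv r awalk_verts[OF d]
    by (intro that[of "Poly_Mapping.single u (1 / c)" "word v" r]) (auto split: if_splits)
qed

section \<open>Larger ideals, and primeness from directedness\<close>

lemma isolate_vertex:
  assumes x: "Poly_Mapping.keys x \<subseteq> words - {[]}" "x \<notin> I"
  obtains a b r where "Poly_Mapping.keys a \<subseteq> words - {[]}" "Poly_Mapping.keys b \<subseteq> words - {[]}"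
    "r \<in> verts E" "\<not> null [Vertex r]" "a * x * b - word [Vertex r] \<in> I"
proof -
  obtain y where y: "Poly_Mapping.keys y \<subseteq> normal_forms" "x - y \<in> I"
    using ex_normal_form[OF x(1)] by blast
  then have "y \<noteq> 0" using x(2) by auto
  then obtain a b r where abr: "Poly_Mapping.keys a \<subseteq> words - {[]}"
    "Poly_Mapping.keys b \<subseteq> words - {[]}" "r \<in> verts E" "\<not> null [Vertex r]"
    "a * y * b - word [Vertex r] \<in> I"
    using isolate_term[OF y(1)] by metis
  have "a * (x - y) * b + (a * y * b - word [Vertex r]) \<in> I"
    using y abr by (intro add_mem mult_mem)
  then have "a * x * b - word [Vertex r] \<in> I" by (simp add: algebra_simps)
  then show thesis using that abr by blast
qed

text \<open>An element of \<open>J\<close> outside \<open>I\<close> could be multiplied, modulo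
  \<open>I\<close>, to a vertex outside \<open>I\<close>. As \<open>I\<close> is contained in
  \<open>J\<close>, this vertex would lie in \<open>J\<close>.\<close>

lemma superideal_subset:
  assumes "rng_ideal J (free_algebra (lpa_gens E))" "I \<subseteq> J"
    and "\<And>v. \<lbrakk>v \<in> verts E; word [Vertex v] \<in> J\<rbrakk> \<Longrightarrow> null [Vertex v]"
  shows "J \<subseteq> I"
proof
  interpret J: rng_ideal J "free_algebra (lpa_gens E)" by fact
  fix x assume "x \<in> J"
  show "x \<in> I"
  proof (rule ccontr)
    assume "x \<notin> I"
    have x: "Poly_Mapping.keys x \<subseteq> words - {[]}" using \<open>x \<in> J\<close> J.a_subset by auto
    obtain a b r where abr: "Poly_Mapping.keys a \<subseteq> words - {[]}"
      "Poly_Mapping.keys b \<subseteq> words - {[]}" "r \<in> verts E" "\<not> null [Vertex r]"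
      "a * x * b - word [Vertex r] \<in> I"
      using isolate_vertex[OF x \<open>x \<notin> I\<close>] by metis
    have "a * x \<in> J" using J.I_l_closed[OF \<open>x \<in> J\<close>, of a] abr by simp
    then have axb: "a * x * b \<in> J" using J.I_r_closed[of "a * x" b] abr by simp
    have "word [Vertex r] - a * x * b \<in> J" using uminus_mem[OF abr(5)] assms(2) by auto
    then have "word [Vertex r] - a * x * b + a * x * b \<in> J"
      using axb additive_subgroup.a_closed[OF J.additive_subgroup_axioms] by (metis free_algebra_simps(4))
    then have "word [Vertex r] \<in> J" by simp
    then show False using assms(3) abr by blast
  qed
qed

text \<open>Elements \<open>x\<close> and \<open>y\<close> outside \<open>I\<close> are multiplied
  to vertices \<open>p\<close> and \<open>q\<close>, which are joined by \<open>s t*\<close> for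
  paths \<open>s\<close> from \<open>p\<close> and \<open>t\<close> from \<open>q\<close> to a
  common \<open>r\<close> outside \<open>I\<close>. If all products through \<open>x\<close> and
  \<open>y\<close> were in \<open>I\<close>, then so would be \<open>p s t* q\<close>, and hence
  \<open>s* (p s t* q) t = r\<close>.\<close>

lemma prime_if_directed:
  assumes "\<exists>v \<in> verts E. \<not> null [Vertex v]"
    and "\<And>p q. \<lbrakk>p \<in> verts E; q \<in> verts E; \<not> null [Vertex p]; \<not> null [Vertex q]\<rbrakk>
      \<Longrightarrow> \<exists>r a b. awalk p a r \<and> awalk q b r \<and> \<not> null [Vertex r]"
  shows "rng_prime_ideal I (free_algebra (lpa_gens E))"
proof -
  have "I \<noteq> carrier (free_algebra (lpa_gens E))"
  proof
    assume eq: "I = carrier (free_algebra (lpa_gens E))"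
    obtain v where v: "v \<in> verts E" "\<not> null [Vertex v]" using assms(1) by blast
    then have "word [Vertex v] \<in> carrier (free_algebra (lpa_gens E))" by simp
    then show False using v(2) eq unfolding null_def by blast
  qed
  moreover have "x \<in> I \<or> y \<in> I"
    if x: "x \<in> carrier (free_algebra (lpa_gens E))" and y: "y \<in> carrier (free_algebra (lpa_gens E))"
      and prod: "\<And>r. r \<in> carrier (free_algebra (lpa_gens E)) \<Longrightarrow>
        x \<otimes>\<^bsub>free_algebra (lpa_gens E)\<^esub> r \<otimes>\<^bsub>free_algebra (lpa_gens E)\<^esub> y \<in> I"
    for x y
  proof (rule ccontr)
    assume "\<not> (x \<in> I \<or> y \<in> I)"
    then have "x \<notin> I" "y \<notin> I" by auto
    obtain a b p where p: "Poly_Mapping.keys a \<subseteq> words - {[]}"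
      "Poly_Mapping.keys b \<subseteq> words - {[]}" "p \<in> verts E" "\<not> null [Vertex p]"
      "a * x * b - word [Vertex p] \<in> I"
      using isolate_vertex[OF _ \<open>x \<notin> I\<close>] x by (metis (mono_tags) free_algebra_simps(1) mem_Collect_eq)
    obtain c d q where q: "Poly_Mapping.keys c \<subseteq> words - {[]}"
      "Poly_Mapping.keys d \<subseteq> words - {[]}" "q \<in> verts E" "\<not> null [Vertex q]"
      "c * y * d - word [Vertex q] \<in> I"
      using isolate_vertex[OF _ \<open>y \<notin> I\<close>] y by (metis (mono_tags) free_algebra_simps(1) mem_Collect_eq)
    obtain r s t where r: "awalk p s r" "awalk q t r" "\<not> null [Vertex r]"
      using assms(2)[OF p(3) q(3) p(4) q(4)] by blast
    note arcs = awalk_arcs[OF r(1)] awalk_arcs[OF r(2)]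
    note verts = awalk_verts[OF r(1)] awalk_verts[OF r(2)]
    define m :: "_ \<Rightarrow>\<^sub>0 'k" where "m = word (nf p s t q)"
    have m: "Poly_Mapping.keys m \<subseteq> words - {[]}" using arcs verts by (auto simp: m_def nf_def)
    let ?vp = "word [Vertex p] :: _ \<Rightarrow>\<^sub>0 'k" and ?vq = "word [Vertex q] :: _ \<Rightarrow>\<^sub>0 'k"
    have "Poly_Mapping.keys (b * m * c) \<subseteq> words - {[]}"
      using p(2) q(1) m by (intro keys_mult_words)
    then have "x * (b * m * c) * y \<in> I"
      using prod[of "b * m * c"] by (simp only: free_algebra_simps mem_Collect_eq)
    then have "a * (x * (b * m * c) * y) * d \<in> I"
      using p(1) q(2) mult_mem(1)[OF mult_mem(2)] by blast
    then have 1: "(a * x * b) * m * (c * y * d) \<in> I" by (simp add: mult.assoc)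
    have 2: "(a * x * b - ?vp) * m * (c * y * d) \<in> I"
      using p(5) m q y by (intro mult_mem(1) keys_mult_words) auto
    have 3: "?vp * m * (c * y * d - ?vq) \<in> I"
      using p(3) m q(5) by (intro mult_mem(2) keys_mult_words) auto
    \<comment> \<open>The factors \<open>a x b\<close> and \<open>c y d\<close> are replaced by
      \<open>p\<close> and \<open>q\<close> one after the other; each replacement changes the
      product by an element of \<open>I\<close>.\<close>
    have "?vp * m * ?vq = (a * x * b) * m * (c * y * d)
        - (a * x * b - ?vp) * m * (c * y * d) - ?vp * m * (c * y * d - ?vq)"
      by (simp add: algebra_simps)
    then have "?vp * m * ?vq \<in> I" using 1 2 3 by (simp only: diff_mem)
    then have "word (map Ghost (rev s)) * (?vp * m * ?vq) * word (map Edge t) \<in> I"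
      using word_mult_mem arcs by simp
    then have "null (map Ghost (rev (s @ [])) @ Vertex p # nf p s t q @ Vertex q # map Edge (t @ []))"
      by (simp add: null_def m_def word_mult)
    moreover have "awalk r [] r" using verts by (simp add: awalk_Nil_iff)
    ultimately show False using nf_cancel[OF r(1,2)] r(3) weq_null by blast
  qed
  ultimately show ?thesis
    by (intro rng_prime_ideal.intro rng_prime_ideal_axioms.intro rng_ideal_axioms) blast+
qed

end

section \<open>Ideals with prescribed vertices\<close>

text \<open>
  If \<open>E\<close> has no regular vertices and \<open>U\<close> contains \<open>tail E e\<close> whenever it contains \<open>head E e\<close>, then
  these operators satisfy the relations of the Leavitt path algebra. The pair \<open>(v, w)\<close> plays the role of a path \<open>w\<close> starting at \<open>v\<close>;
  whether \<open>w\<close> really is such a path need not be checked.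
\<close>

fun act :: "('v, 'e) pre_digraph \<Rightarrow> 'v set \<Rightarrow> ('v, 'e) lpa_gen \<Rightarrow> ('v \<times> 'e list \<Rightarrow> 'k::field)
    \<Rightarrow> 'v \<times> 'e list \<Rightarrow> 'k" where
  "act E U (Vertex v) h (p, w) = (if p = v \<and> v \<in> U then h (p, w) else 0)"
| "act E U (Edge e) h (p, w) =
    (if w \<noteq> [] \<and> hd w = e \<and> p = tail E e \<and> head E e \<in> U then h (head E e, tl w) else 0)"
| "act E U (Ghost e) h (p, w) = (if p = head E e \<and> head E e \<in> U then h (tail E e, e # w) else 0)"

definition act_poly :: "('v, 'e) pre_digraph \<Rightarrow> 'v set \<Rightarrow> (('v, 'e) lpa_gen list \<Rightarrow>\<^sub>0 'k::field)
    \<Rightarrow> ('v \<times> 'e list \<Rightarrow> 'k) \<Rightarrow> 'v \<times> 'e list \<Rightarrow> 'k" where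
  "act_poly E U f h y = (\<Sum>w\<in>Poly_Mapping.keys f. Poly_Mapping.lookup f w * foldr (act E U) w h y)"

lemma act_sum: "act E U g (\<lambda>y. \<Sum>i\<in>A. c i * h i y) = (\<lambda>y. \<Sum>i\<in>A. c i * act E U g (h i) y)"
proof
  fix y show "act E U g (\<lambda>y. \<Sum>i\<in>A. c i * h i y) y = (\<Sum>i\<in>A. c i * act E U g (h i) y)"
    by (cases y; cases g) auto
qed

lemma foldr_act_sum:
  "foldr (act E U) u (\<lambda>y. \<Sum>i\<in>A. c i * h i y) = (\<lambda>y. \<Sum>i\<in>A. c i * foldr (act E U) u (h i) y)"
  by (induction u) (simp_all add: act_sum)

lemma act_poly_superset:
  "\<lbrakk>finite W; Poly_Mapping.keys f \<subseteq> W\<rbrakk>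
    \<Longrightarrow> act_poly E U f h y = (\<Sum>w\<in>W. Poly_Mapping.lookup f w * foldr (act E U) w h y)"
  unfolding act_poly_def by (intro sum.mono_neutral_left) (auto simp: in_keys_iff)

lemma act_poly_add: "act_poly E U (f + g) h y = act_poly E U f h y + act_poly E U g h y"
proof -
  let ?W = "Poly_Mapping.keys f \<union> Poly_Mapping.keys g"
  have "act_poly E U (f + g) h y = (\<Sum>w\<in>?W. Poly_Mapping.lookup (f + g) w * foldr (act E U) w h y)"
    by (intro act_poly_superset keys_add) simp
  also have "\<dots> = act_poly E U f h y + act_poly E U g h y"
    by (simp add: act_poly_superset[of ?W f] act_poly_superset[of ?W g] lookup_add
        distrib_right sum.distrib)
  finally show ?thesis .
qed

lemma act_poly_zero [simp]: "act_poly E U 0 h y = 0"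
  by (simp add: act_poly_def)

lemma act_poly_diff: "act_poly E U (f - g) h y = act_poly E U f h y - act_poly E U g h y"
  using act_poly_add[of E U "f - g" g h y] by simp

lemma act_poly_single [simp]:
  "act_poly E U (Poly_Mapping.single w c) h y = c * foldr (act E U) w h y"
  by (simp add: act_poly_def)

lemma act_poly_sum: "act_poly E U (\<Sum>i\<in>A. f i) h y = (\<Sum>i\<in>A. act_poly E U (f i) h y)"
  by (induction A rule: infinite_finite_induct) (simp_all add: act_poly_add)

lemma act_poly_mult: "act_poly E U (f * g) h y = act_poly E U f (act_poly E U g h) y"
proof -
  have "f * g = (\<Sum>u\<in>Poly_Mapping.keys f. \<Sum>v\<in>Poly_Mapping.keys g.
      Poly_Mapping.single (u @ v) (Poly_Mapping.lookup f u * Poly_Mapping.lookup g v))"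
    by (subst sum_monomials[of f], subst sum_monomials[of g])
      (simp add: sum_product mult_single plus_list_def)
  then have "act_poly E U (f * g) h y = (\<Sum>u\<in>Poly_Mapping.keys f. \<Sum>v\<in>Poly_Mapping.keys g.
      Poly_Mapping.lookup f u * Poly_Mapping.lookup g v * foldr (act E U) u (foldr (act E U) v h) y)"
    by (simp add: act_poly_sum)
  also have "\<dots> = act_poly E U f (act_poly E U g h) y"
    by (simp add: act_poly_def[abs_def] foldr_act_sum sum_distrib_left mult.assoc)
  finally show ?thesis .
qed

text \<open>The ideal is the kernel of the representation. Closure of \<open>U\<close> under tails
  is what (E1) and (E2) demand at the tail of an edge, and (CK2) imposes no condition without
  regular vertices.\<close>

lemma (in wf_digraph) ex_leavitt_ideal:
  fixes U :: "'a set"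
  assumes "\<And>v. \<not> regular_vertex G v"
    and up: "\<And>e. \<lbrakk>e \<in> arcs G; head G e \<in> U\<rbrakk> \<Longrightarrow> tail G e \<in> U"
  obtains I :: "(('a, 'b) lpa_gen list \<Rightarrow>\<^sub>0 'k::field) set"
  where "leavitt_ideal G I"
    and "\<And>v. v \<in> verts G \<Longrightarrow> word [Vertex v] \<in> I \<longleftrightarrow> v \<notin> U"
proof -
  let ?F = "free_algebra (lpa_gens G) :: ('k, ('a, 'b) lpa_gen list \<Rightarrow>\<^sub>0 'k) module"
  define I :: "(('a, 'b) lpa_gen list \<Rightarrow>\<^sub>0 'k) set"
    where "I = {f \<in> carrier ?F. \<forall>h y. act_poly G U f h y = 0}"
  interpret F: rng ?F by (rule rng_free_algebra)
  have act0: "act_poly G U f (\<lambda>_. 0) y = 0" for f :: "('a, 'b) lpa_gen list \<Rightarrow>\<^sub>0 'k" and y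
  proof -
    have "foldr (act G U) w (\<lambda>y. 0 :: 'k) = (\<lambda>_. 0)" for w
      using foldr_act_sum[where A = "{} :: nat set" and E = G and U = U and u = w] by simp
    then show ?thesis by (simp add: act_poly_def)
  qed
  have "rng_ideal I ?F"
  proof (rule F.rng_idealI)
    fix x assume x: "x \<in> I"
    then have "act_poly G U (- x) h y = 0" for h y
      using act_poly_diff[of G U 0 x h y] by (cases y) (simp add: I_def)
    moreover have "\<ominus>\<^bsub>?F\<^esub> x = - x" using x by (intro free_algebra_a_inv) (simp add: I_def)
    moreover have "\<ominus>\<^bsub>?F\<^esub> x \<in> carrier ?F" using x by (intro F.a_inv_closed) (simp add: I_def)
    ultimately show "\<ominus>\<^bsub>?F\<^esub> x \<in> I" by (simp add: I_def)
  next
    fix x y assume "x \<in> I" "y \<in> I"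
    then show "x \<oplus>\<^bsub>?F\<^esub> y \<in> I" using F.a_closed[of x y] by (simp add: I_def act_poly_add)
  next
    fix a x assume ax: "a \<in> I" "x \<in> carrier ?F"
    then have a: "act_poly G U a h = (\<lambda>_. 0)" for h by (auto simp: I_def)
    show "x \<otimes>\<^bsub>?F\<^esub> a \<in> I" "a \<otimes>\<^bsub>?F\<^esub> x \<in> I"
      using ax F.m_closed[of x a] F.m_closed[of a x] by (simp_all add: I_def act_poly_mult act0 a)
  qed (auto simp: I_def)
  moreover have "Poly_Mapping.map ((*) c) x \<in> I" if "x \<in> I" for c x
    using that map_scale_closed[of x "lpa_gens G" c]
    by (simp add: I_def mult_map_scale_conv_mult act_poly_mult zero_list_def)
  moreover have "lpa_rels G \<subseteq> I"
  proof
    fix f :: "('a, 'b) lpa_gen list \<Rightarrow>\<^sub>0 'k" assume f: "f \<in> lpa_rels G"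
    have "act_poly G U f h (p, w) = 0" for h p w
      using f assms(1) up unfolding lpa_rels_def
      by (auto simp: act_poly_diff)
    then have "act_poly G U f h y = 0" for h y by (cases y) simp
    moreover have "f \<in> carrier ?F" using f lpa_rels_carrier by blast
    ultimately show "f \<in> I" unfolding I_def by blast
  qed
  ultimately have "leavitt_ideal G I"
    by (intro leavitt_ideal.intro leavitt_ideal_axioms.intro wf_digraph_axioms)
  moreover have "word [Vertex v] \<in> I \<longleftrightarrow> v \<notin> U" if "v \<in> verts G" for v
  proof
    assume "word [Vertex v] \<in> I"
    \<comment> \<open>A vertex in \<open>U\<close> would fix the value 1 of the constant function at
      the trivial path \<open>(v, [])\<close>.\<close>
    then have "act_poly G U (word [Vertex v]) (\<lambda>_. 1 :: 'k) (v, []) = 0" unfolding I_def by blast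
    then show "v \<notin> U" by auto
  qed (use that in \<open>auto simp: I_def lpa_gens_def\<close>)
  ultimately show thesis by (rule that)
qed

lemma leavitt_ideal_Int:
  assumes "leavitt_ideal E I" "leavitt_ideal E J" shows "leavitt_ideal E (I \<inter> J)"
proof -
  interpret I: leavitt_ideal E I by fact
  interpret J: leavitt_ideal E J by fact
  have "rng_ideal (I \<inter> J) (free_algebra (lpa_gens E))"
  proof (rule I.rng_idealI)
    show "I \<inter> J \<subseteq> carrier (free_algebra (lpa_gens E))" using I.a_subset by blast
  next
    fix x assume x: "x \<in> I \<inter> J"
    then have "\<ominus>\<^bsub>free_algebra (lpa_gens E)\<^esub> x = - x"
      using I.mem_carrier[of x] by (intro free_algebra_a_inv) simp
    then show "\<ominus>\<^bsub>free_algebra (lpa_gens E)\<^esub> x \<in> I \<inter> J"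
      using x by (simp add: I.uminus_mem J.uminus_mem)
  qed (auto intro: I.add_mem J.add_mem I.mult_mem J.mult_mem)
  then show ?thesis
    using I.rels J.rels I.scalar_closed J.scalar_closed
    by (intro leavitt_ideal.intro leavitt_ideal_axioms.intro I.wf_digraph_axioms) auto
qed

section \<open>The graph of a poset\<close>

lemma poset_graph_simps [simp]:
  "verts (poset_graph P) = P"
  "(i, p, q) \<in> arcs (poset_graph P) \<longleftrightarrow> p \<in> P \<and> q \<in> P \<and> q < p"
  "tail (poset_graph P) (i, p, q) = p" "head (poset_graph P) (i, p, q) = q"
  by (auto simp: poset_graph_def)

lemma wf_poset_graph: "wf_digraph (poset_graph P)"
  by unfold_locales (auto simp: poset_graph_def)

lemma not_regular_poset_graph: "\<not> regular_vertex (poset_graph P) v"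
proof
  assume "regular_vertex (poset_graph P) v"
  then obtain e where fin: "finite (out_arcs (poset_graph P) v)" and "e \<in> out_arcs (poset_graph P) v"
    unfolding regular_vertex_def by blast
  then obtain i p q where e: "(i, p, q) \<in> out_arcs (poset_graph P) v" by (cases e) auto
  have "range (\<lambda>n. (n, p, q)) \<subseteq> out_arcs (poset_graph P) v" using e by (auto simp: out_arcs_def)
  then have "finite (range (\<lambda>n. (n :: nat, p, q)))" using fin finite_subset by blast
  then show False by (subst (asm) finite_image_iff) (auto simp: inj_on_def)
qed

lemma awalk_poset_graph:
  assumes "pre_digraph.awalk (poset_graph P) p a q" shows "q \<le> p" "a \<noteq> [] \<Longrightarrow> q < p"
proof -
  interpret wf_digraph "poset_graph P" by (rule wf_poset_graph)
  have "a \<noteq> [] \<longrightarrow> q < p" "q \<le> p"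
    using assms by (induction a arbitrary: p) (fastforce simp: awalk_Nil_iff awalk_Cons_iff)+
  then show "q \<le> p" "a \<noteq> [] \<Longrightarrow> q < p" by auto
qed

lemma ex_awalk_poset_graph:
  assumes "p \<in> P" "q \<in> P" "q \<le> p" shows "\<exists>a. pre_digraph.awalk (poset_graph P) p a q"
proof -
  interpret wf_digraph "poset_graph P" by (rule wf_poset_graph)
  show ?thesis
  proof (cases "p = q")
    case True
    then show ?thesis using assms by (intro exI[of _ "[]"]) (simp add: awalk_Nil_iff)
  next
    case False
    then show ?thesis
      using assms by (intro exI[of _ "[(0, p, q)]"]) (simp add: awalk_Nil_iff awalk_Cons_iff)
  qed
qed

text \<open>Parallel copies of an edge share their head, so if one of them has its head outside the
  ideal, all infinitely many do.\<close>

lemma leavitt_ideal_poset_graph: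
  assumes "leavitt_ideal (poset_graph P) I" shows "fresh_leavitt_ideal (poset_graph P) I"
proof -
  interpret leavitt_ideal "poset_graph P" I by fact
  show ?thesis
  proof
    show "a = []" if "awalk p a p" for p a using awalk_poset_graph[OF that] by blast
    fix S :: "(nat \<times> 'a \<times> 'a) set" and e
    assume S: "finite S" and e: "e \<in> arcs (poset_graph P)" "\<not> null [Vertex (head (poset_graph P) e)]"
    obtain i p q where ipq: "e = (i, p, q)" by (metis prod_cases3)
    have "\<not> finite (range (\<lambda>n. (n :: nat, p, q)))"
      by (subst finite_image_iff) (auto simp: inj_on_def)
    then obtain n where "(n, p, q) \<notin> S" using S by (meson finite_subset image_subsetI)
    then show "\<exists>f\<in>arcs (poset_graph P) - S. tail (poset_graph P) f = tail (poset_graph P) e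
        \<and> \<not> null [Vertex (head (poset_graph P) f)]"
      using e by (intro bexI[of _ "(n, p, q)"]) (auto simp: ipq)
  qed
qed

section \<open>Prime ideals and directed upsets\<close>

definition live :: "'p set \<Rightarrow> (('p, 'e) lpa_gen list \<Rightarrow>\<^sub>0 'k::field) set \<Rightarrow> 'p set" where
  "live P I = {p \<in> P. word [Vertex p] \<notin> I}"

text \<open>The order-theoretic filters of \<open>P\<close>.\<close>

definition directed_upsets :: "'p::order set \<Rightarrow> 'p set set" where
  "directed_upsets P = {U. U \<subseteq> P \<and> downward_directed U \<and> (\<forall>p\<in>U. \<forall>q\<in>P. p \<le> q \<longrightarrow> q \<in> U)}"

text \<open>\<open>superideal_subset\<close> compares nested ideals only, so \<open>I\<close> is
  compared with \<open>I \<inter> J\<close>. By the inclusion of live sets, every vertex in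
  \<open>I\<close> is also in \<open>J\<close>, hence in the intersection.\<close>

lemma leavitt_ideal_subset_iff:
  assumes "leavitt_ideal (poset_graph P) I" "leavitt_ideal (poset_graph P) J"
  shows "I \<subseteq> J \<longleftrightarrow> live P J \<subseteq> live P I"
proof
  assume sub: "live P J \<subseteq> live P I"
  interpret I: leavitt_ideal "poset_graph P" I by fact
  interpret IJ: fresh_leavitt_ideal "poset_graph P" "I \<inter> J"
    by (intro leavitt_ideal_poset_graph leavitt_ideal_Int assms)
  have "I \<subseteq> I \<inter> J"
  proof (rule IJ.superideal_subset)
    fix v assume "v \<in> verts (poset_graph P)" "word [Vertex v] \<in> I"
    then show "IJ.null [Vertex v]" using sub by (auto simp: IJ.null_def live_def)
  qed (auto intro: I.rng_ideal_axioms)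
  then show "I \<subseteq> J" by blast
qed (auto simp: live_def)

lemma prime_leavitt_ideal:
  assumes "rng_prime_ideal I (free_algebra (lpa_gens (poset_graph P)))" "lpa_rels (poset_graph P) \<subseteq> I"
  shows "leavitt_ideal (poset_graph P) I"
proof -
  interpret rng_prime_ideal I "free_algebra (lpa_gens (poset_graph P))" by fact
  show ?thesis
    using assms prime_ideal_scalar_closed[OF assms(1)]
    by (intro leavitt_ideal.intro leavitt_ideal_axioms.intro wf_poset_graph rng_ideal_axioms) auto
qed

text \<open>For directedness, primeness yields \<open>p x q\<close> outside \<open>I\<close> for
  some \<open>x\<close>, hence \<open>p w q\<close> outside \<open>I\<close> for some word
  \<open>w\<close> of \<open>x\<close>. Its normal form \<open>a b*\<close> has paths
  \<open>a\<close> from \<open>p\<close> and \<open>b\<close> from \<open>q\<close> to a common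
  vertex outside \<open>I\<close>, and paths in the graph descend in \<open>P\<close>.\<close>

lemma live_prime:
  fixes I :: "(('p::order, nat \<times> 'p \<times> 'p) lpa_gen list \<Rightarrow>\<^sub>0 'k::field) set"
  assumes prime: "rng_prime_ideal I (free_algebra (lpa_gens (poset_graph P)))"
    and "lpa_rels (poset_graph P) \<subseteq> I"
  shows "live P I \<in> directed_upsets P"
proof -
  interpret fresh_leavitt_ideal "poset_graph P" I
    by (intro leavitt_ideal_poset_graph prime_leavitt_ideal assms)
  interpret prime: rng_prime_ideal I "free_algebra (lpa_gens (poset_graph P))" by fact
  let ?F = "free_algebra (lpa_gens (poset_graph P))"
  have "live P I \<noteq> {}"
  proof
    assume "live P I = {}"
    \<comment> \<open>If no vertex is live, every vertex is in \<open>I\<close>, and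
      \<open>superideal_subset\<close> applies with the whole algebra as larger ideal.\<close>
    then have "carrier ?F \<subseteq> I"
      by (intro superideal_subset rng_idealI a_subset)
        (auto simp: live_def null_def simp del: free_algebra_simps intro: m_closed)
    then show False using prime.I_proper a_subset by blast
  qed
  moreover have "\<exists>r\<in>live P I. r \<le> p \<and> r \<le> q" if "p \<in> live P I" "q \<in> live P I" for p q
  proof -
    have p: "p \<in> P" "word [Vertex p] \<notin> I" and q: "q \<in> P" "word [Vertex q] \<notin> I"
      using that by (auto simp: live_def)
    have carr: "word [Vertex p] \<in> carrier ?F" "word [Vertex q] \<in> carrier ?F" using p q by auto
    obtain x where x: "x \<in> carrier ?F" "word [Vertex p] * x * word [Vertex q] \<notin> I"
      using prime.I_prime[OF carr] p q by auto
    have "word [Vertex p] * (\<Sum>w\<in>W. Poly_Mapping.single w (h w)) * word [Vertex q]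
        = (\<Sum>w\<in>W. Poly_Mapping.single (Vertex p # w @ [Vertex q]) (h w))"
      for W and h :: "_ \<Rightarrow> 'k"
      by (simp add: sum_distrib_left sum_distrib_right mult_single plus_list_def)
    from this[of "Poly_Mapping.lookup x" "Poly_Mapping.keys x"]
    have "(\<Sum>w\<in>Poly_Mapping.keys x. Poly_Mapping.single (Vertex p # w @ [Vertex q])
        (Poly_Mapping.lookup x w)) \<notin> I"
      using x(2) by (simp flip: sum_monomials)
    then have "\<exists>w\<in>Poly_Mapping.keys x. \<not> null (Vertex p # w @ [Vertex q])"
      by (blast intro: sum_mem null_scale)
    then obtain w where w: "w \<in> words" "\<not> null (Vertex p # w @ [Vertex q])"
      using x(1) by auto
    let ?w = "Vertex p # w @ [Vertex q]"
    have w': "?w \<in> words" using w p q by simp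
    then obtain p' a b q' r where a: "awalk p' a r" and b: "awalk q' b r" and nf: "?w \<sim> nf p' a b q'"
      using reducible_word[of ?w] w(2) by (auto simp: reducible_def)
    \<comment> \<open>Vertices are idempotent, so a further \<open>p\<close> on the left or
      \<open>q\<close> on the right leaves the word unchanged modulo \<open>I\<close>. It would
      annihilate a normal form with other end vertices.\<close>
    have "?w \<sim> [Vertex p] @ ?w"
      using weq_inside(1)[of "[]" "w @ [Vertex q]" p] w p q by (simp add: weq_sym)
    also have "\<dots> \<sim> [Vertex p] @ nf p' a b q'" using weq_in[OF nf, of "[Vertex p]" "[]"] p by simp
    finally have 1: "\<not> null ([Vertex p] @ nf p' a b q')" using w weq_null by blast
    have "?w \<sim> ?w @ [Vertex q]"
      using weq_inside(1)[of "Vertex p # w" "[]" q] w p q by (simp add: weq_sym)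
    also have "\<dots> \<sim> nf p' a b q' @ [Vertex q]" using weq_in[OF nf, of "[]" "[Vertex q]"] q by simp
    finally have 2: "\<not> null (nf p' a b q' @ [Vertex q])" using w weq_null by blast
    note words = awalk_arcs[OF a] awalk_arcs[OF b] awalk_verts[OF a] awalk_verts[OF b]
    have "p = p'"
    proof (rule ccontr)
      assume "p \<noteq> p'"
      then have "null ([] @ Vertex p # Vertex p' # map Edge a @ map Ghost (rev b) @ [Vertex q'])"
        using words p by (intro null_inside) auto
      then show False using 1 by (simp add: nf_def)
    qed
    moreover have "q = q'"
    proof (rule ccontr)
      assume "q \<noteq> q'"
      then have "null ((Vertex p' # map Edge a @ map Ghost (rev b)) @ Vertex q' # Vertex q # [])"
        using words q by (intro null_inside) auto
      then show False using 2 by (simp add: nf_def)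
    qed
    moreover have "\<not> null [Vertex r]" using null_nf[OF a b] nf w(2) weq_null by blast
    ultimately show ?thesis
      using awalk_poset_graph(1)[OF a] awalk_poset_graph(1)[OF b] words(3)
      by (intro bexI[of _ r]) (auto simp: live_def null_def)
  qed
  moreover have "q \<in> live P I" if "p \<in> live P I" "q \<in> P" "p \<le> q" for p q
    using that ex_awalk_poset_graph[of q P p] vertex_hereditary by (auto simp: live_def null_def)
  ultimately show ?thesis
    by (auto simp: directed_upsets_def downward_directed_def live_def[of P I])
qed

lemma ex_prime_live:
  assumes U: "U \<in> directed_upsets P"
  obtains I :: "(('p::order, nat \<times> 'p \<times> 'p) lpa_gen list \<Rightarrow>\<^sub>0 'k::field) set"
  where "rng_prime_ideal I (free_algebra (lpa_gens (poset_graph P)))"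
    and "lpa_rels (poset_graph P) \<subseteq> I" and "live P I = U"
proof -
  interpret wf_digraph "poset_graph P" by (rule wf_poset_graph)
  obtain I :: "(('p, nat \<times> 'p \<times> 'p) lpa_gen list \<Rightarrow>\<^sub>0 'k) set"
    where I: "leavitt_ideal (poset_graph P) I"
      and v: "\<And>v. v \<in> P \<Longrightarrow> word [Vertex v] \<in> I \<longleftrightarrow> v \<notin> U"
  proof (rule ex_leavitt_ideal[of U])
    show "tail (poset_graph P) e \<in> U" if "e \<in> arcs (poset_graph P)" "head (poset_graph P) e \<in> U" for e
      using that U by (cases e) (auto simp: directed_upsets_def)
  qed (auto simp: not_regular_poset_graph)
  interpret fresh_leavitt_ideal "poset_graph P" I by (rule leavitt_ideal_poset_graph[OF I])
  have live: "live P I = U" using v U by (auto simp: live_def directed_upsets_def)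
  have null: "null [Vertex v] \<longleftrightarrow> v \<notin> U" if "v \<in> P" for v using v that by (simp add: null_def)
  have "rng_prime_ideal I (free_algebra (lpa_gens (poset_graph P)))"
  proof (rule prime_if_directed)
    show "\<exists>v\<in>verts (poset_graph P). \<not> null [Vertex v]"
      using U null by (auto simp: directed_upsets_def downward_directed_def)
    fix p q assume pq: "p \<in> verts (poset_graph P)" "q \<in> verts (poset_graph P)"
      "\<not> null [Vertex p]" "\<not> null [Vertex q]"
    then have "p \<in> U" "q \<in> U" using null by auto
    then obtain r where r: "r \<in> U" "r \<in> P" "r \<le> p" "r \<le> q"
      using U unfolding directed_upsets_def downward_directed_def by blast
    then show "\<exists>r a b. awalk p a r \<and> awalk q b r \<and> \<not> null [Vertex r]"
      using ex_awalk_poset_graph pq null by (metis poset_graph_simps(1))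
  qed
  then show thesis using that rels live by blast
qed

lemma live_bij:
  "bij_betw (live P) {I \<in> Spec (free_algebra (lpa_gens (poset_graph P))
      :: ('k::field, ('p::order, nat \<times> 'p \<times> 'p) lpa_gen list \<Rightarrow>\<^sub>0 'k) module).
     lpa_rels (poset_graph P) \<subseteq> I} (directed_upsets P)"
proof (rule bij_betwI')
  let ?S = "{I \<in> Spec (free_algebra (lpa_gens (poset_graph P))
      :: ('k, ('p, nat \<times> 'p \<times> 'p) lpa_gen list \<Rightarrow>\<^sub>0 'k) module). lpa_rels (poset_graph P) \<subseteq> I}"
  show "live P I = live P J \<longleftrightarrow> I = J" if "I \<in> ?S" "J \<in> ?S" for I J
    using that leavitt_ideal_subset_iff[OF prime_leavitt_ideal prime_leavitt_ideal, of I P J]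
      leavitt_ideal_subset_iff[OF prime_leavitt_ideal prime_leavitt_ideal, of J P I]
    by (auto simp: Spec_def)
  show "live P I \<in> directed_upsets P" if "I \<in> ?S" for I
    using that live_prime by (auto simp: Spec_def)
  show "\<exists>I\<in>?S. U = live P I" if "U \<in> directed_upsets P" for U
    using ex_prime_live[OF that, where ?'k = 'k] by (auto simp: Spec_def)
qed

section \<open>Directed upsets and the completion\<close>

text \<open>The union over the class \<open>C\<close> avoids the choice of a representative.\<close>

fun upset_of :: "'p::order set \<Rightarrow> 'p completion \<Rightarrow> 'p set" where
  "upset_of P (Orig p) = {q \<in> P. p \<le> q}"
| "upset_of P (Limit C) = \<Union>C"

lemma set_le_trans: "\<lbrakk>S \<preceq> T; T \<preceq> V\<rbrakk> \<Longrightarrow> S \<preceq> V"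
  unfolding set_le_def by (meson order_trans)

lemma limit_sets_subset: "S \<in> limit_sets P \<Longrightarrow> S \<subseteq> P \<and> S \<noteq> {}"
  by (auto simp: limit_sets_def downward_directed_def)

text \<open>The upward closure of \<open>S\<close> is the largest member of the class of \<open>S\<close>.\<close>

lemma upset_of_limit:
  assumes "S \<in> limit_sets P" shows "upset_of P (limit_of P S) = {q \<in> P. \<exists>s\<in>S. s \<le> q}"
proof -
  note S = limit_sets_subset[OF assms]
  have "S \<subseteq> {q \<in> P. \<exists>s\<in>S. s \<le> q}" using S by auto
  then have "{q \<in> P. \<exists>s\<in>S. s \<le> q} \<in> set_equiv P `` {S}"
    using S by (auto simp: set_equiv_def set_le_def)
  moreover have "T \<subseteq> {q \<in> P. \<exists>s\<in>S. s \<le> q}" if "T \<in> set_equiv P `` {S}" for T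
    using that by (auto simp: set_equiv_def set_le_def)
  ultimately have "\<Union>(set_equiv P `` {S}) = {q \<in> P. \<exists>s\<in>S. s \<le> q}"
    by (intro equalityI Union_least Union_upper)
  then show ?thesis by simp
qed

lemma completion_cases:
  assumes "a \<in> completion P"
  obtains p where "p \<in> P" "a = Orig p" | S where "S \<in> limit_sets P" "a = limit_of P S"
  using assms by (auto simp: completion_def)

text \<open>The four rules become one inclusion, since an upset lies in another as soon as its
  generators do: \<open>p\<close> itself, or the members of \<open>S\<close>. The order axioms are
  thereby inherited from inclusion.\<close>

lemma completion_le_iff:
  "(a, b) \<in> completion_le P \<longleftrightarrow>
    a \<in> completion P \<and> b \<in> completion P \<and> upset_of P b \<subseteq> upset_of P a"
proof
  assume "(a, b) \<in> completion_le P"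
  then show "a \<in> completion P \<and> b \<in> completion P \<and> upset_of P b \<subseteq> upset_of P a"
  proof cases
    case (1 p q)
    then show ?thesis by (auto simp: completion_def)
  next
    case (2 p S)
    have "upset_of P b = {q \<in> P. \<exists>s\<in>S. s \<le> q}"
      unfolding 2(2) by (rule upset_of_limit[OF 2(4)])
    moreover have "p \<le> q" if "s \<in> S" "s \<le> q" for s q using 2(5) that by (meson order_trans)
    ultimately show ?thesis using 2 by (auto simp: completion_def)
  next
    case (3 S q)
    have "upset_of P a = {q \<in> P. \<exists>s\<in>S. s \<le> q}"
      unfolding 3(1) by (rule upset_of_limit[OF 3(3)])
    moreover have "\<exists>s\<in>S. s \<le> q'" if "q \<le> q'" for q' using 3(5) that by (meson order_trans)
    ultimately show ?thesis using 3 by (auto simp: completion_def)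
  next
    case (4 S T)
    have "upset_of P a = {q \<in> P. \<exists>s\<in>S. s \<le> q}" "upset_of P b = {q \<in> P. \<exists>t\<in>T. t \<le> q}"
      unfolding 4(1,2) by (rule upset_of_limit[OF 4(3)], rule upset_of_limit[OF 4(4)])
    moreover have "\<exists>s\<in>S. s \<le> q" if "t \<in> T" "t \<le> q" for t q
      using 4(5) that unfolding set_le_def by (meson order_trans)
    ultimately show ?thesis using 4 by (auto simp: completion_def)
  qed
next
  assume "a \<in> completion P \<and> b \<in> completion P \<and> upset_of P b \<subseteq> upset_of P a"
  then have a: "a \<in> completion P" and b: "b \<in> completion P"
    and sub: "upset_of P b \<subseteq> upset_of P a" by auto
  from a show "(a, b) \<in> completion_le P"
  proof (cases rule: completion_cases)
    case a: (1 p)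
    from b show ?thesis
    proof (cases rule: completion_cases)
      case b: (1 q)
      then have "p \<le> q" using a sub by auto
      then show ?thesis using a b by (auto intro: completion_le.intros)
    next
      case b: (2 T)
      have "T \<subseteq> upset_of P b" unfolding b(2) upset_of_limit[OF b(1)] using limit_sets_subset[OF b(1)] by blast
      then have "\<forall>t\<in>T. p \<le> t" using sub a by auto
      then show ?thesis using a b by (auto intro: completion_le.intros)
    qed
  next
    case a: (2 S)
    have up: "upset_of P a = {q \<in> P. \<exists>s\<in>S. s \<le> q}" unfolding a(2) by (rule upset_of_limit[OF a(1)])
    from b show ?thesis
    proof (cases rule: completion_cases)
      case b: (1 q)
      then have "q \<in> upset_of P b" by simp
      then have "\<exists>s\<in>S. s \<le> q" using up sub by auto
      then show ?thesis using a b by (auto intro: completion_le.intros)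
    next
      case b: (2 T)
      have "T \<subseteq> upset_of P b" unfolding b(2) upset_of_limit[OF b(1)] using limit_sets_subset[OF b(1)] by blast
      then have "S \<preceq> T" using up sub by (auto simp: set_le_def)
      then show ?thesis using a b by (auto intro: completion_le.intros)
    qed
  qed
qed

lemma limit_of_eq:
  assumes "S \<in> limit_sets P" "T \<in> limit_sets P" "S \<preceq> T" "T \<preceq> S"
  shows "limit_of P S = limit_of P T"
proof -
  have "(S, V) \<in> set_equiv P \<longleftrightarrow> (T, V) \<in> set_equiv P" for V
  proof -
    have "S \<preceq> V \<longleftrightarrow> T \<preceq> V" "V \<preceq> S \<longleftrightarrow> V \<preceq> T"
      using set_le_trans assms(3,4) by blast+
    then show ?thesis
      using limit_sets_subset[OF assms(1)] limit_sets_subset[OF assms(2)] by (simp add: set_equiv_def)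
  qed
  then show ?thesis by (simp add: Image_singleton)
qed

lemma inj_on_upset_of: "inj_on (upset_of P) (completion P)"
proof (rule inj_onI)
  \<comment> \<open>If both upsets agreed, \<open>p\<close> would be below all of \<open>S\<close>
    and above some \<open>s\<close> in \<open>S\<close>. Then \<open>p = s\<close> would be the
    least element of \<open>S\<close>, which a limit set does not have.\<close>
  have *: "upset_of P (Orig p) \<noteq> upset_of P (limit_of P S)" if "p \<in> P" "S \<in> limit_sets P" for p S
  proof
    assume "upset_of P (Orig p) = upset_of P (limit_of P S)"
    then have eq: "{q \<in> P. p \<le> q} = {q \<in> P. \<exists>s\<in>S. s \<le> q}" using upset_of_limit[OF that(2)] by simp
    have "p \<in> {q \<in> P. \<exists>s\<in>S. s \<le> q}" unfolding eq[symmetric] using that(1) by simp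
    then obtain s where s: "s \<in> S" "s \<le> p" by auto
    have least: "\<forall>s\<in>S. p \<le> s"
    proof
      fix s assume "s \<in> S"
      then have "s \<in> {q \<in> P. \<exists>s\<in>S. s \<le> q}" using limit_sets_subset[OF that(2)] by auto
      then show "p \<le> s" unfolding eq[symmetric] by simp
    qed
    then have "p \<in> S" using s order_antisym[of s p] by auto
    then show False using least that(2) by (auto simp: limit_sets_def has_least_def)
  qed
  fix a b assume a: "a \<in> completion P" and b: "b \<in> completion P" and eq: "upset_of P a = upset_of P b"
  from a show "a = b"
  proof (cases rule: completion_cases)
    case a: (1 p)
    from b show ?thesis
    proof (cases rule: completion_cases)
      case b: (1 q)
      have "p \<in> upset_of P a" "q \<in> upset_of P b" using a b by simp_all
      then have "p \<in> upset_of P b" "q \<in> upset_of P a" by (simp_all only: eq)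
      then show ?thesis using a b by auto
    next
      case b: (2 T)
      then show ?thesis using *[OF a(1) b(1)] eq unfolding a(2) b(2) by blast
    qed
  next
    case a: (2 S)
    from b show ?thesis
    proof (cases rule: completion_cases)
      case b: (1 q)
      then show ?thesis using *[OF b(1) a(1)] eq unfolding a(2) b(2) by metis
    next
      case b: (2 T)
      have "{q \<in> P. \<exists>s\<in>S. s \<le> q} = {q \<in> P. \<exists>t\<in>T. t \<le> q}"
        using eq unfolding a(2) b(2) upset_of_limit[OF a(1)] upset_of_limit[OF b(1)] .
      moreover have "T \<subseteq> {q \<in> P. \<exists>t\<in>T. t \<le> q}" "S \<subseteq> {q \<in> P. \<exists>s\<in>S. s \<le> q}"
        using limit_sets_subset[OF a(1)] limit_sets_subset[OF b(1)] by auto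
      ultimately have "T \<subseteq> {q \<in> P. \<exists>s\<in>S. s \<le> q}" "S \<subseteq> {q \<in> P. \<exists>t\<in>T. t \<le> q}"
        by simp_all
      then have "S \<preceq> T" "T \<preceq> S" by (auto simp: set_le_def)
      then show ?thesis unfolding a(2) b(2) by (rule limit_of_eq[OF a(1) b(1)])
    qed
  qed
qed

lemma directed_upsetsI:
  assumes "U \<subseteq> P" "U \<noteq> {}" "\<And>p q. \<lbrakk>p \<in> U; q \<in> U\<rbrakk> \<Longrightarrow> \<exists>r\<in>U. r \<le> p \<and> r \<le> q"
    and "\<And>p q. \<lbrakk>p \<in> U; q \<in> P; p \<le> q\<rbrakk> \<Longrightarrow> q \<in> U"
  shows "U \<in> directed_upsets P"
  using assms unfolding directed_upsets_def downward_directed_def by blast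

text \<open>For surjectivity, a filter with a least element is principal, and one without is itself
  a limit set whose upward closure is the filter again.\<close>

lemma upset_of_image: "upset_of P ` completion P = directed_upsets P"
proof (intro equalityI subsetI)
  fix U assume "U \<in> upset_of P ` completion P"
  then obtain a where a: "a \<in> completion P" "U = upset_of P a" by blast
  from a(1) show "U \<in> directed_upsets P"
  proof (cases rule: completion_cases)
    case (1 p)
    have U: "q \<in> U \<longleftrightarrow> q \<in> P \<and> p \<le> q" for q using 1 a(2) by simp
    show ?thesis
    proof (rule directed_upsetsI)
      show "\<exists>r\<in>U. r \<le> q \<and> r \<le> q'" if "q \<in> U" "q' \<in> U" for q q'
        using that 1(1) by (intro bexI[of _ p]) (simp_all add: U)
      show "q' \<in> U" if "q \<in> U" "q' \<in> P" "q \<le> q'" for q q'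
        using that order_trans[of p q q'] by (simp add: U)
    qed (use 1(1) U in auto)
  next
    case (2 S)
    have U_eq: "U = {q \<in> P. \<exists>s\<in>S. s \<le> q}" unfolding a(2) 2(2) by (rule upset_of_limit[OF 2(1)])
    have U: "q \<in> U \<longleftrightarrow> q \<in> P \<and> (\<exists>s\<in>S. s \<le> q)" for q by (simp add: U_eq)
    have S: "S \<subseteq> P" "S \<noteq> {}" "\<forall>p\<in>S. \<forall>q\<in>S. \<exists>r\<in>S. r \<le> p \<and> r \<le> q"
      using 2(1) unfolding limit_sets_def downward_directed_def by blast+
    have "S \<subseteq> U" using S(1) U by blast
    show ?thesis
    proof (rule directed_upsetsI)
      fix p q assume "p \<in> U" "q \<in> U"
      then obtain s t where st: "s \<in> S" "t \<in> S" "s \<le> p" "t \<le> q" using U by blast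
      then obtain r where r: "r \<in> S" "r \<le> s" "r \<le> t" using S(3) by blast
      then show "\<exists>r\<in>U. r \<le> p \<and> r \<le> q"
        using \<open>S \<subseteq> U\<close> st order_trans[of r s p] order_trans[of r t q] by blast
    next
      show "q \<in> U" if "p \<in> U" "q \<in> P" "p \<le> q" for p q
        using that U by (meson order_trans)
    qed (use \<open>S \<subseteq> U\<close> S(2) U in blast)+
  qed
next
  fix U assume U: "U \<in> directed_upsets P"
  then have U': "U \<subseteq> P" "\<And>p q. \<lbrakk>p \<in> U; q \<in> P; p \<le> q\<rbrakk> \<Longrightarrow> q \<in> U"
    by (auto simp: directed_upsets_def)
  show "U \<in> upset_of P ` completion P"
  proof (cases "has_least U")
    case True
    then obtain m where m: "m \<in> U" "\<forall>s\<in>U. m \<le> s" by (auto simp: has_least_def)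
    have "U = upset_of P (Orig m)"
    proof
      show "U \<subseteq> upset_of P (Orig m)" using m(2) U'(1) by auto
      show "upset_of P (Orig m) \<subseteq> U" using U'(2)[OF m(1)] by auto
    qed
    moreover have "Orig m \<in> completion P" using m(1) U'(1) by (auto simp: completion_def)
    ultimately show ?thesis by (rule image_eqI)
  next
    case False
    then have L: "U \<in> limit_sets P" using U by (auto simp: limit_sets_def directed_upsets_def)
    have "{q \<in> P. \<exists>s\<in>U. s \<le> q} = U"
    proof
      show "{q \<in> P. \<exists>s\<in>U. s \<le> q} \<subseteq> U" using U'(2) by blast
      show "U \<subseteq> {q \<in> P. \<exists>s\<in>U. s \<le> q}" using U'(1) by auto
    qed
    then have "U = upset_of P (limit_of P U)" by (simp only: upset_of_limit[OF L])
    moreover have "limit_of P U \<in> completion P" using L unfolding completion_def by blast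
    ultimately show ?thesis by (rule image_eqI)
  qed
qed

section \<open>The order on the completion and the isomorphism\<close>

lemma partial_order_completion: "partial_order_on (completion P) (completion_le P)"
proof -
  have "antisym (completion_le P)"
  proof (rule antisymI)
    fix a b assume "(a, b) \<in> completion_le P" "(b, a) \<in> completion_le P"
    then show "a = b" using inj_onD[OF inj_on_upset_of, of P a b] unfolding completion_le_iff by blast
  qed
  moreover have "trans (completion_le P)" by (rule transI) (unfold completion_le_iff, blast)
  moreover have "refl_on (completion P) (completion_le P)"
    by (simp add: refl_on_def completion_le_iff)
  moreover have "completion_le P \<subseteq> completion P \<times> completion P"
    by (rule subrelI) (simp add: completion_le_iff)
  ultimately show ?thesis by (simp add: partial_order_on_def preorder_on_def)
qed

theorem theorem18:
  fixes P :: "'p::order set"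
  assumes "P \<noteq> {}"
  shows "partial_order_on (completion P) (completion_le P) \<and>
    (\<exists>\<phi>. bij_betw \<phi> (Spec (leavitt_path_algebra TYPE('k::field) (poset_graph P))) (completion P) \<and>
      (\<forall>I \<in> Spec (leavitt_path_algebra TYPE('k) (poset_graph P)).
       \<forall>J \<in> Spec (leavitt_path_algebra TYPE('k) (poset_graph P)).
         I \<subseteq> J \<longleftrightarrow> (\<phi> I, \<phi> J) \<in> completion_le P))"
proof -
  define L where "L = leavitt_path_algebra TYPE('k) (poset_graph P)"
  let ?S = "{I \<in> Spec (free_algebra (lpa_gens (poset_graph P))
      :: ('k, ('p, nat \<times> 'p \<times> 'p) lpa_gen list \<Rightarrow>\<^sub>0 'k) module). lpa_rels (poset_graph P) \<subseteq> I}"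
  interpret wf_digraph "poset_graph P" by (rule wf_poset_graph)
  have "\<exists>f. bij_betw f (Spec L) ?S \<and> (\<forall>I \<in> Spec L. \<forall>J \<in> Spec L. f I \<subseteq> f J \<longleftrightarrow> I \<subseteq> J)"
    unfolding L_def leavitt_path_algebra_def by (rule Spec_presented_algebra[OF lpa_rels_carrier])
  then obtain f where f: "bij_betw f (Spec L) ?S"
    and f_sub: "\<forall>I \<in> Spec L. \<forall>J \<in> Spec L. f I \<subseteq> f J \<longleftrightarrow> I \<subseteq> J"
    by (elim exE conjE)
  have up: "bij_betw (upset_of P) (completion P) (directed_upsets P)"
    by (simp add: bij_betw_def inj_on_upset_of upset_of_image)
  \<comment> \<open>\<open>f\<close> preserves inclusion, \<open>live P\<close> reverses it, and
    \<open>upset_of P\<close> turns the order of the completion into reverse inclusion. The two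
    reversals cancel.\<close>
  define \<phi> where "\<phi> = the_inv_into (completion P) (upset_of P) \<circ> (live P \<circ> f)"
  have bij: "bij_betw (live P \<circ> f) (Spec L) (directed_upsets P)"
    using f live_bij by (rule bij_betw_trans)
  have \<phi>: "bij_betw \<phi> (Spec L) (completion P)"
    unfolding \<phi>_def using bij bij_betw_the_inv_into[OF up] by (rule bij_betw_trans)
  have "I \<subseteq> J \<longleftrightarrow> (\<phi> I, \<phi> J) \<in> completion_le P" if I: "I \<in> Spec L" and J: "J \<in> Spec L" for I J
  proof -
    have upset: "upset_of P (\<phi> A) = live P (f A)" if "A \<in> Spec L" for A
    proof -
      have "live P (f A) \<in> directed_upsets P"
        using that bij_betwE[OF bij] by simp
      then show ?thesis
        unfolding \<phi>_def using f_the_inv_into_f_bij_betw[OF up] by simp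
    qed
    have leavitt: "leavitt_ideal (poset_graph P) (f A)" if "A \<in> Spec L" for A
    proof -
      have "f A \<in> ?S" using bij_betwE[OF f] that by blast
      then show ?thesis by (intro prime_leavitt_ideal) (simp_all add: Spec_def)
    qed
    have "I \<subseteq> J \<longleftrightarrow> live P (f J) \<subseteq> live P (f I)"
      using f_sub I J leavitt_ideal_subset_iff[OF leavitt[OF I] leavitt[OF J]] by simp
    then show ?thesis
      using bij_betwE[OF \<phi>] I J by (simp add: completion_le_iff upset)
  qed
  then show ?thesis using partial_order_completion \<phi> unfolding L_def by blast
qed

end
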